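(* There is a universal constant $C>0$ with the following property. Let $\{X_k\}_{k=1}^\infty$ be a sequence of random variables and $\{\varphi_k\}_{k=1}^\infty$, $\{\phi_k\}_{k=1}^\infty$ sequences of non-negative numbers such that $$|\mathbb E X_iX_jX_kX_l|\le\min\{\varphi_{j-i},\varphi_{k-j},\varphi_{l-k}\}\quad\text{for all } i<j<k<l,$$ $$\mathrm{Cov}(X_i^2,X_j^2)\le\phi_{j-i}\quad\text{for all } i<j.$$ Suppose that $\Phi_0+\Phi_1+\Phi_2<\infty$, where $\Phi_0=\sup\{\mathbb E X_k^4:k\ge1\}$, $\Phi_1=\sum_{k=1}^\infty k\varphi_k$ and $\Phi_2=\sum_{k=1}^\infty\phi_k$. Then, for every $p\ge 1$ and all real $p\times p$ matrices $A$, $$\mathbb E|\mathbf x_p^\top A\mathbf x_p-\mathrm{tr}(\Sigma_pA)|^2\le C(\Phi_0+\Phi_1+\Phi_2)\,\mathrm{tr}(AA^\top),$$ where $\Sigma_p$ is the diagonal matrix with diagonal entries $\mathbb E X_1^2,\dots,\mathbb E X_p^2$.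
   Context: $\mathbf x_p=(X_1,\dots,X_p)$, regarded as a column vector in $\mathbb R^p$. *)

theory Defs
  imports "HOL-Probability.Probability" "Jordan_Normal_Form.Matrix"
begin

definition covariance :: "'a measure \<Rightarrow> ('a \<Rightarrow> real) \<Rightarrow> ('a \<Rightarrow> real) \<Rightarrow> real" where
  "covariance M Y Z =
     (\<integral>\<omega>. (Y \<omega> - (\<integral>\<omega>'. Y \<omega>' \<partial>M)) * (Z \<omega> - (\<integral>\<omega>'. Z \<omega>' \<partial>M)) \<partial>M)"

definition mat_trace :: "real mat \<Rightarrow> real" where
  "mat_trace A = (\<Sum>i<dim_row A. A $$ (i, i))"

text \<open>Sequences are indexed from 1 (the value at index 0 is never used), whereas
  vectors and matrices are indexed from 0; hence the shifts below.\<close>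

definition rv_vec :: "(nat \<Rightarrow> 'a \<Rightarrow> real) \<Rightarrow> nat \<Rightarrow> 'a \<Rightarrow> real Matrix.vec" where
  "rv_vec X p \<omega> = Matrix.vec p (\<lambda>i. X (Suc i) \<omega>)"

definition Sigma_mat :: "'a measure \<Rightarrow> (nat \<Rightarrow> 'a \<Rightarrow> real) \<Rightarrow> nat \<Rightarrow> real mat" where
  "Sigma_mat M X p = mat_diag p (\<lambda>i. \<integral>\<omega>. (X (Suc i) \<omega>)\<^sup>2 \<partial>M)"

text \<open>The three quantities below take values in \<open>[0, \<infinity>]\<close>, so that their finiteness is a
  genuine condition. In particular, if \<open>Phi0 M X < \<infinity>\<close>, then all fourth moments
  are finite and the Bochner integrals in the moment conditions exist.\<close>

definition Phi0 :: "'a measure \<Rightarrow> (nat \<Rightarrow> 'a \<Rightarrow> real) \<Rightarrow> ennreal" where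
  "Phi0 M X = (SUP k\<in>{1..}. \<integral>\<^sup>+\<omega>. ennreal (X k \<omega> ^ 4) \<partial>M)"

definition Phi1 :: "(nat \<Rightarrow> real) \<Rightarrow> ennreal" where
  "Phi1 \<phi> = (\<Sum>k. ennreal (real (Suc k) * \<phi> (Suc k)))"

definition Phi2 :: "(nat \<Rightarrow> real) \<Rightarrow> ennreal" where
  "Phi2 \<psi> = (\<Sum>k. ennreal (\<psi> (Suc k)))"

definition moment_conditions ::
  "'a measure \<Rightarrow> (nat \<Rightarrow> 'a \<Rightarrow> real) \<Rightarrow> (nat \<Rightarrow> real) \<Rightarrow> (nat \<Rightarrow> real) \<Rightarrow> bool" where
  "moment_conditions M X \<phi> \<psi> \<longleftrightarrow>
     (\<forall>k\<ge>1. X k \<in> borel_measurable M) \<and>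
     (\<forall>k\<ge>1. 0 \<le> \<phi> k) \<and> (\<forall>k\<ge>1. 0 \<le> \<psi> k) \<and>
     (\<forall>i j k l. 1 \<le> i \<and> i < j \<and> j < k \<and> k < l \<longrightarrow>
        \<bar>\<integral>\<omega>. X i \<omega> * X j \<omega> * X k \<omega> * X l \<omega> \<partial>M\<bar> \<le> Min {\<phi> (j - i), \<phi> (k - j), \<phi> (l - k)}) \<and>
     (\<forall>i j. 1 \<le> i \<and> i < j \<longrightarrow>
        covariance M (\<lambda>\<omega>. (X i \<omega>)\<^sup>2) (\<lambda>\<omega>. (X j \<omega>)\<^sup>2) \<le> \<psi> (j - i)) \<and>
     Phi0 M X + Phi1 \<phi> + Phi2 \<psi> < \<infinity>"

text \<open>\<open>quad_form_bound TYPE('a) C\<close>: the inequality holds with the constant \<open>C\<close> for all random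
  sequences on probability spaces with underlying type \<open>'a\<close>. The left-hand side is a
  nonnegative integral, so the inequality includes square integrability.\<close>

definition quad_form_bound :: "'a itself \<Rightarrow> real \<Rightarrow> bool" where
  "quad_form_bound (_ :: 'a itself) C \<longleftrightarrow>
     (\<forall>(M :: 'a measure) X \<phi> \<psi>. prob_space M \<and> moment_conditions M X \<phi> \<psi> \<longrightarrow>
        (\<forall>p\<ge>1. \<forall>A \<in> carrier_mat p p.
           (\<integral>\<^sup>+\<omega>. ennreal (\<bar>scalar_prod (rv_vec X p \<omega>) (A *\<^sub>v rv_vec X p \<omega>)
                         - mat_trace (Sigma_mat M X p * A)\<bar>\<^sup>2) \<partial>M)
           \<le> ennreal C * (Phi0 M X + Phi1 \<phi> + Phi2 \<psi>)
               * ennreal (mat_trace (A * transpose_mat A))))"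

text \<open>HOL cannot quantify over types below an existential quantifier, so
  \<open>\<exists>C>0. quad_form_bound TYPE('a) C\<close> would let \<open>C\<close> depend on \<open>'a\<close>. A constant is therefore
  called universal via the type \<open>nat \<Rightarrow> real\<close>, which carries the law of every random sequence:
  the theorem asserts that some constant is valid for this type, and that a
  constant valid there is valid for every type \<open>'a\<close>.\<close>

end

theory Submission
  imports Defs
begin

text \<open>Write \<open>x\<^sup>T A x - tr (\<Sigma> A) = D + Q\<close> with \<open>D = \<Sum> a\<^sub>i\<^sub>i (x\<^sub>i\<^sup>2 - E x\<^sub>i\<^sup>2)\<close> and \<open>Q = \<Sum> b\<^sub>i\<^sub>j x\<^sub>i x\<^sub>j\<close>, where \<open>B\<close> is
  the symmetrized off-diagonal part of \<open>A\<close>. The second moment of \<open>D\<close> is a quadratic form in the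
  covariances of the squares. Expanding \<open>Q\<^sup>2\<close>, the terms with four distinct indices are summable by
  the mixed moment condition, and the hypotheses say nothing about the terms with one
  coincidence; together these form \<open>4 \<Sum>\<^sub>i x\<^sub>i\<^sup>2 Y\<^sub>i\<^sup>2\<close>, \<open>Y\<^sub>i = \<Sum>\<^sub>j b\<^sub>i\<^sub>j x\<^sub>j\<close>, up to a term of favourable
  sign. It therefore suffices to bound the fourth moments of linear forms \<open>Y = \<Sum> b\<^sub>i x\<^sub>i\<close>, for which
  one applies the same expansion to the off-diagonal part of \<open>b b\<^sup>T\<close>, that is, to \<open>Y\<^sup>2 - \<Sum> b\<^sub>i\<^sup>2 x\<^sub>i\<^sup>2\<close>,
  and absorbs the resulting \<open>Y\<^sup>4\<close> into the left-hand side.\<close>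

subsection \<open>Sums and matrix expressions\<close>

lemma quad_form_eq:
  assumes "A \<in> carrier_mat p p"
  shows "scalar_prod (rv_vec X p \<omega>) (A *\<^sub>v rv_vec X p \<omega>) =
    (\<Sum>i<p. \<Sum>j<p. A $$ (i, j) * X (Suc i) \<omega> * X (Suc j) \<omega>)"
  using assms unfolding rv_vec_def scalar_prod_def
  by (auto simp: scalar_prod_def sum_distrib_left lessThan_atLeast0 algebra_simps intro!: sum.cong)

lemma mat_trace_Sigma_mat:
  assumes "A \<in> carrier_mat p p"
  shows "mat_trace (Sigma_mat M X p * A) = (\<Sum>i<p. A $$ (i, i) * (\<integral>\<omega>. (X (Suc i) \<omega>)\<^sup>2 \<partial>M))"
proof -
  have "Sigma_mat M X p * A =
      mat p p (\<lambda>(i, j). (\<integral>\<omega>. (X (Suc i) \<omega>)\<^sup>2 \<partial>M) * A $$ (i, j))"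
    unfolding Sigma_mat_def using assms by (rule mat_diag_mult_left)
  then show ?thesis
    by (simp add: mat_trace_def mult.commute)
qed

lemma mat_trace_mult_transpose:
  assumes "A \<in> carrier_mat p p"
  shows "mat_trace (A * transpose_mat A) = (\<Sum>i<p. \<Sum>j<p. (A $$ (i, j))\<^sup>2)"
  using assms by (auto simp: mat_trace_def scalar_prod_def lessThan_atLeast0 power2_eq_square
      intro!: sum.cong)

text \<open>Two rounds of \<open>2 * \<bar>u * v\<bar> \<le> u\<^sup>2 + v\<^sup>2\<close>: first
  for \<open>x * y\<close> and \<open>z * w\<close>, then for the squares. The constant is not
  sharp, but the bound only serves as an integrable majorant.\<close>

lemma quartic_product_bound:
  fixes x y z w :: real
  shows "\<bar>x * y * z * w\<bar> \<le> x ^ 4 + y ^ 4 + z ^ 4 + w ^ 4"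
proof -
  have two: "2 * \<bar>u * v\<bar> \<le> u\<^sup>2 + v\<^sup>2" for u v :: real
    using sum_squares_bound[of "\<bar>u\<bar>" "\<bar>v\<bar>"] by (simp add: abs_mult mult.assoc)
  have "2 * \<bar>(x * y) * (z * w)\<bar> \<le> x\<^sup>2 * y\<^sup>2 + z\<^sup>2 * w\<^sup>2"
    using two[of "x * y" "z * w"] by (simp add: power_mult_distrib)
  moreover have "2 * (x\<^sup>2 * y\<^sup>2) \<le> x ^ 4 + y ^ 4" "2 * (z\<^sup>2 * w\<^sup>2) \<le> z ^ 4 + w ^ 4"
    using sum_squares_bound[of "x\<^sup>2" "y\<^sup>2"] sum_squares_bound[of "z\<^sup>2" "w\<^sup>2"] by auto
  moreover have "0 \<le> x ^ 4" "0 \<le> y ^ 4" "0 \<le> z ^ 4" "0 \<le> w ^ 4" by auto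
  ultimately show ?thesis by (simp add: mult.assoc)
qed

text \<open>The minimum is at most the value of \<open>f\<close> at the larger index, and each half
  of the square contains \<open>k\<close> pairs with larger index \<open>k\<close>. This count is
  the source of the weight \<open>k\<close> in \<open>Phi1\<close>.\<close>

lemma sum_min_le:
  fixes f :: "nat \<Rightarrow> real"
  assumes "\<And>k. 1 \<le> k \<Longrightarrow> 0 \<le> f k"
  shows "(\<Sum>a\<in>{1..n}. \<Sum>b\<in>{1..n}. min (f a) (f b)) \<le> 2 * (\<Sum>k=1..n. real k * f k)"
proof -
  have half: "(\<Sum>a\<in>{1..n}. \<Sum>b\<in>{1..n}. if b \<le> a then f a else 0) = (\<Sum>k=1..n. real k * f k)"
  proof (rule sum.cong[OF refl])
    fix a assume a: "a \<in> {1..n}"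
    have "(\<Sum>b\<in>{1..n}. if b \<le> a then f a else 0) = (\<Sum>b\<in>{1..a}. f a)"
      using a by (intro sum.mono_neutral_cong_right) auto
    then show "(\<Sum>b\<in>{1..n}. if b \<le> a then f a else 0) = real a * f a" by simp
  qed
  \<comment> \<open>Pairs with \<open>a = b\<close> occur in both halves, which is harmless because
    \<open>f\<close> is nonnegative.\<close>
  have "(\<Sum>a\<in>{1..n}. \<Sum>b\<in>{1..n}. min (f a) (f b))
      \<le> (\<Sum>a\<in>{1..n}. \<Sum>b\<in>{1..n}. (if b \<le> a then f a else 0) + (if a \<le> b then f b else 0))"
    using assms by (intro sum_mono) auto
  also have "\<dots> = (\<Sum>a\<in>{1..n}. \<Sum>b\<in>{1..n}. if b \<le> a then f a else 0) +
      (\<Sum>a\<in>{1..n}. \<Sum>b\<in>{1..n}. if a \<le> b then f b else 0)"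
    by (simp add: sum.distrib)
  also have "(\<Sum>a\<in>{1..n}. \<Sum>b\<in>{1..n}. if a \<le> b then f b else 0)
      = (\<Sum>a\<in>{1..n}. \<Sum>b\<in>{1..n}. if b \<le> a then f a else 0)"
    by (rule sum.swap)
  finally show ?thesis using half by simp
qed

lemma sum_le_sum_reindex:
  fixes g :: "'b \<Rightarrow> real"
  assumes "finite S" "inj_on h P" "h ` P \<subseteq> S" "\<And>s. s \<in> S \<Longrightarrow> 0 \<le> g s"
  shows "(\<Sum>x\<in>P. g (h x)) \<le> sum g S"
proof -
  have "(\<Sum>x\<in>P. g (h x)) = sum g (h ` P)" using assms(2) by (simp add: sum.reindex)
  also have "\<dots> \<le> sum g S" using assms by (intro sum_mono2) auto
  finally show ?thesis .
qed

lemma sum_swap3: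
  "(\<Sum>a\<in>A. \<Sum>b\<in>B. \<Sum>c\<in>C. g a b c) = (\<Sum>b\<in>B. \<Sum>c\<in>C. \<Sum>a\<in>A. g a b c)"
  by (rule trans[OF sum.swap], intro sum.cong refl, rule sum.swap)

lemma sum_swap_pairs:
  "(\<Sum>i\<in>A. \<Sum>j\<in>B. \<Sum>k\<in>C. \<Sum>l\<in>D. f i j k l) = (\<Sum>k\<in>C. \<Sum>l\<in>D. \<Sum>i\<in>A. \<Sum>j\<in>B. f i j k l)"
proof -
  have "(\<Sum>i\<in>A. \<Sum>j\<in>B. \<Sum>k\<in>C. \<Sum>l\<in>D. f i j k l) = (\<Sum>i\<in>A. \<Sum>k\<in>C. \<Sum>l\<in>D. \<Sum>j\<in>B. f i j k l)"
    by (intro sum.cong refl sum_swap3)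
  then show ?thesis by (rule trans[OF _ sum_swap3])
qed

text \<open>Inclusion-exclusion over the coincidences between the pairs \<open>(i, j)\<close> and
  \<open>(k, l)\<close>. The zero diagonal leaves only \<open>i \<noteq> j\<close> and
  \<open>k \<noteq> l\<close>, so there are four single coincidences, with equal sums by symmetry,
  and two double ones, each counted twice among the single ones.\<close>

lemma square_quad_form:
  fixes B :: "nat \<Rightarrow> nat \<Rightarrow> real" and x :: "nat \<Rightarrow> real"
  assumes sym: "\<And>i j. B i j = B j i" and diag: "\<And>i. B i i = 0"
  shows "(\<Sum>i<p. \<Sum>j<p. B i j * x i * x j)\<^sup>2 =
    (\<Sum>i<p. \<Sum>j<p. \<Sum>k<p. \<Sum>l<p.
        if distinct [i, j, k, l] then B i j * B k l * (x i * x j * x k * x l) else 0)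
    + 4 * (\<Sum>i<p. (x i)\<^sup>2 * (\<Sum>j<p. B i j * x j)\<^sup>2)
    - 2 * (\<Sum>i<p. \<Sum>j<p. (B i j)\<^sup>2 * (x i)\<^sup>2 * (x j)\<^sup>2)"
proof -
  define t where "t i j k l = B i j * B k l * (x i * x j * x k * x l)" for i j k l
  define S where "S f = (\<Sum>i<p. \<Sum>j<p. \<Sum>k<p. \<Sum>l<p. f i j k l)" for f :: "nat \<Rightarrow> nat \<Rightarrow> nat \<Rightarrow> nat \<Rightarrow> real"
  \<comment> \<open>If \<open>i = j\<close> or \<open>k = l\<close>, every term vanishes. Otherwise
    at most two of the four equalities hold, and two can only be \<open>i = k\<close>,
    \<open>j = l\<close> or \<open>i = l\<close>, \<open>j = k\<close>.\<close>
  have split: "t i j k l = (if distinct [i, j, k, l] then t i j k l else 0)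
      + (if i = k then t i j k l else 0) + (if i = l then t i j k l else 0)
      + (if j = k then t i j k l else 0) + (if j = l then t i j k l else 0)
      - (if i = k then if j = l then t i j k l else 0 else 0)
      - (if i = l then if j = k then t i j k l else 0 else 0)" for i j k l
    by (cases "i = j"; cases "k = l") (auto simp: t_def diag)
  define R where "R = (\<Sum>i<p. (x i)\<^sup>2 * (\<Sum>j<p. B i j * x j)\<^sup>2)"
  have R: "R = (\<Sum>i<p. \<Sum>j<p. \<Sum>l<p. t i j i l)"
    unfolding R_def
    by (intro sum.cong refl) (simp add: t_def power2_eq_square sum_product sum_distrib_left mult_ac)
  \<comment> \<open>These bring the other three single coincidences into the form in which
    \<open>R\<close> is expanded.\<close>
  have t_sym: "t i j k i = t i j i k" "t i j j l = t j i j l" "t i j k j = t j i j k" for i j k l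
    by (simp_all add: t_def sym mult_ac)
  have "(\<Sum>i<p. \<Sum>j<p. B i j * x i * x j)\<^sup>2 =
      (\<Sum>i<p. \<Sum>j<p. (B i j * x i * x j) * (\<Sum>k<p. \<Sum>l<p. B k l * x k * x l))"
    unfolding power2_eq_square by (simp only: sum_distrib_right)
  also have "\<dots> = S t"
    unfolding S_def by (simp add: sum_distrib_left t_def mult_ac)
  also have "S t = S (\<lambda>i j k l. if distinct [i, j, k, l] then t i j k l else 0)
      + S (\<lambda>i j k l. if i = k then t i j k l else 0) + S (\<lambda>i j k l. if i = l then t i j k l else 0)
      + S (\<lambda>i j k l. if j = k then t i j k l else 0) + S (\<lambda>i j k l. if j = l then t i j k l else 0)
      - S (\<lambda>i j k l. if i = k then if j = l then t i j k l else 0 else 0)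
      - S (\<lambda>i j k l. if i = l then if j = k then t i j k l else 0 else 0)"
  proof -
    have "S t = S (\<lambda>i j k l. (if distinct [i, j, k, l] then t i j k l else 0)
      + (if i = k then t i j k l else 0) + (if i = l then t i j k l else 0)
      + (if j = k then t i j k l else 0) + (if j = l then t i j k l else 0)
      - (if i = k then if j = l then t i j k l else 0 else 0)
      - (if i = l then if j = k then t i j k l else 0 else 0))"
      by (intro arg_cong[of _ _ S] ext split)
    then show ?thesis
      unfolding S_def by (simp only: sum.distrib sum_subtractf)
  qed
  also have "S (\<lambda>i j k l. if i = k then t i j k l else 0) = R"
  proof -
    have "(\<Sum>k<p. \<Sum>l<p. if i = k then t i j k l else 0) = (\<Sum>l<p. t i j i l)" if "i < p" for i j
      using that by (subst sum.swap) simp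
    then show ?thesis unfolding S_def R by simp
  qed
  also have "S (\<lambda>i j k l. if i = l then t i j k l else 0) = R"
  proof -
    have "(\<Sum>k<p. \<Sum>l<p. if i = l then t i j k l else 0) = (\<Sum>k<p. t i j i k)" if "i < p" for i j
      using that by (simp, intro sum.cong refl t_sym)
    then show ?thesis unfolding S_def R by simp
  qed
  also have "S (\<lambda>i j k l. if j = k then t i j k l else 0) = R"
  proof -
    have "(\<Sum>k<p. \<Sum>l<p. if j = k then t i j k l else 0) = (\<Sum>l<p. t j i j l)" if "j < p" for i j
      using that by (subst sum.swap) (simp, intro sum.cong refl t_sym)
    then have "S (\<lambda>i j k l. if j = k then t i j k l else 0) = (\<Sum>i<p. \<Sum>j<p. \<Sum>l<p. t j i j l)"
      unfolding S_def by simp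
    also have "\<dots> = R" unfolding R by (rule sum.swap)
    finally show ?thesis .
  qed
  also have "S (\<lambda>i j k l. if j = l then t i j k l else 0) = R"
  proof -
    have "(\<Sum>k<p. \<Sum>l<p. if j = l then t i j k l else 0) = (\<Sum>k<p. t j i j k)" if "j < p" for i j
      using that by (simp, intro sum.cong refl t_sym)
    then have "S (\<lambda>i j k l. if j = l then t i j k l else 0) = (\<Sum>i<p. \<Sum>j<p. \<Sum>l<p. t j i j l)"
      unfolding S_def by simp
    also have "\<dots> = R" unfolding R by (rule sum.swap)
    finally show ?thesis .
  qed
  also have "S (\<lambda>i j k l. if i = k then if j = l then t i j k l else 0 else 0) =
      (\<Sum>i<p. \<Sum>j<p. (B i j)\<^sup>2 * (x i)\<^sup>2 * (x j)\<^sup>2)"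
  proof -
    have "(\<Sum>k<p. \<Sum>l<p. if i = k then if j = l then t i j k l else 0 else 0) =
        (B i j)\<^sup>2 * (x i)\<^sup>2 * (x j)\<^sup>2" if "i < p" "j < p" for i j
    proof -
      have "(\<Sum>k<p. \<Sum>l<p. if i = k then if j = l then t i j k l else 0 else 0) =
         (\<Sum>k<p. if i = k then t i j k j else 0)"
        using that by (intro sum.cong) auto
      then show ?thesis using that by (simp add: t_def power2_eq_square)
    qed
    then show ?thesis unfolding S_def by simp
  qed
  also have "S (\<lambda>i j k l. if i = l then if j = k then t i j k l else 0 else 0) =
      (\<Sum>i<p. \<Sum>j<p. (B i j)\<^sup>2 * (x i)\<^sup>2 * (x j)\<^sup>2)"
  proof -
    have "(\<Sum>k<p. \<Sum>l<p. if i = l then if j = k then t i j k l else 0 else 0) =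
        (B i j)\<^sup>2 * (x i)\<^sup>2 * (x j)\<^sup>2" if "i < p" "j < p" for i j
    proof -
      have "(\<Sum>k<p. \<Sum>l<p. if i = l then if j = k then t i j k l else 0 else 0) =
         (\<Sum>k<p. if j = k then t i j k i else 0)"
        using that by (intro sum.cong) auto
      then show ?thesis using that by (simp add: t_def power2_eq_square sym[of j i])
    qed
    then show ?thesis unfolding S_def by simp
  qed
  finally show ?thesis unfolding S_def t_def R_def by simp
qed

lemma sum_power2_le:
  fixes f :: "'b \<Rightarrow> real"
  assumes "\<And>i. i \<in> I \<Longrightarrow> 0 \<le> f i"
  shows "(\<Sum>i\<in>I. (f i)\<^sup>2) \<le> (\<Sum>i\<in>I. f i)\<^sup>2"
  using assms
proof (induction I rule: infinite_finite_induct)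
  case (insert i I)
  then have "0 \<le> 2 * (f i * sum f I)" by (intro mult_nonneg_nonneg sum_nonneg) auto
  then show ?case using insert by (simp add: power2_sum)
qed auto

subsection \<open>Random variables with finite fourth moment\<close>

text \<open>Measurability is recorded separately because that of the fourth power does not determine
  it: the sign is lost.\<close>

definition fourth_moment :: "'a measure \<Rightarrow> ('a \<Rightarrow> real) \<Rightarrow> bool" where
  "fourth_moment M f \<longleftrightarrow> f \<in> borel_measurable M \<and> integrable M (\<lambda>\<omega>. f \<omega> ^ 4)"

lemma fourth_moment_mult:
  assumes "fourth_moment M f" "fourth_moment M g" "fourth_moment M h" "fourth_moment M k"
  shows "integrable M (\<lambda>\<omega>. f \<omega> * g \<omega> * h \<omega> * k \<omega>)"
proof (rule Bochner_Integration.integrable_bound)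
  show "integrable M (\<lambda>\<omega>. f \<omega> ^ 4 + g \<omega> ^ 4 + h \<omega> ^ 4 + k \<omega> ^ 4)"
    using assms by (auto simp: fourth_moment_def)
  show "(\<lambda>\<omega>. f \<omega> * g \<omega> * h \<omega> * k \<omega>) \<in> borel_measurable M"
    using assms by (auto simp: fourth_moment_def)
  have "norm (f \<omega> * g \<omega> * h \<omega> * k \<omega>) \<le> norm (f \<omega> ^ 4 + g \<omega> ^ 4 + h \<omega> ^ 4 + k \<omega> ^ 4)" for \<omega>
    using quartic_product_bound[of "f \<omega>" "g \<omega>" "h \<omega>" "k \<omega>"] by (smt (verit) real_norm_def)
  then show "AE \<omega> in M. norm (f \<omega> * g \<omega> * h \<omega> * k \<omega>) \<le> norm (f \<omega> ^ 4 + g \<omega> ^ 4 + h \<omega> ^ 4 + k \<omega> ^ 4)"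
    by simp
qed

lemma fourth_moment_mult2:
  assumes "fourth_moment M f" "fourth_moment M g"
  shows "integrable M (\<lambda>\<omega>. (f \<omega>)\<^sup>2 * (g \<omega>)\<^sup>2)"
  using fourth_moment_mult[OF assms(1) assms(1) assms(2) assms(2)]
  by (simp add: power2_eq_square mult_ac)

text \<open>The fourth power expands into finitely many fourfold products, each integrable by
  \<open>fourth_moment_mult\<close>.\<close>

lemma fourth_moment_sum:
  assumes "finite I" "\<And>i. i \<in> I \<Longrightarrow> fourth_moment M (f i)"
  shows "fourth_moment M (\<lambda>\<omega>. \<Sum>i\<in>I. c i * f i \<omega>)"
proof -
  have "(\<lambda>\<omega>. (\<Sum>i\<in>I. c i * f i \<omega>) ^ 4) = (\<lambda>\<omega>. \<Sum>i\<in>I. \<Sum>j\<in>I. \<Sum>k\<in>I. \<Sum>l\<in>I.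
      c i * c j * c k * c l * (f i \<omega> * f j \<omega> * f k \<omega> * f l \<omega>))"
    by (simp add: power4_eq_xxxx sum_distrib_left sum_distrib_right mult_ac)
  moreover have "integrable M (\<lambda>\<omega>. \<Sum>i\<in>I. \<Sum>j\<in>I. \<Sum>k\<in>I. \<Sum>l\<in>I.
      c i * c j * c k * c l * (f i \<omega> * f j \<omega> * f k \<omega> * f l \<omega>))"
    using assms by (intro Bochner_Integration.integrable_sum integrable_mult_right fourth_moment_mult)
  ultimately show ?thesis
    using assms unfolding fourth_moment_def
    by (auto intro!: borel_measurable_sum borel_measurable_times)
qed

subsection \<open>Weakly dependent sequences\<close>

text \<open>The real constants \<open>F0\<close>, \<open>F1\<close>, \<open>F2\<close> stand for the
  extended values of \<open>Phi0\<close>, \<open>Phi1\<close>, \<open>Phi2\<close>, with the series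
  bounded through their partial sums. Indices start at 0 to match sums over \<open>i < p\<close>,
  while gaps still start at 1.\<close>

locale weakly_dependent = prob_space M for M :: "'a measure" +
  fixes x :: "nat \<Rightarrow> 'a \<Rightarrow> real" and \<phi> \<psi> :: "nat \<Rightarrow> real" and F0 F1 F2 :: real
  assumes fourth_moment [simp]: "\<And>i. fourth_moment M (x i)"
    and expectation_4: "\<And>i. expectation (\<lambda>\<omega>. x i \<omega> ^ 4) \<le> F0"
    and phi_nonneg: "\<And>k. 1 \<le> k \<Longrightarrow> 0 \<le> \<phi> k"
    and psi_nonneg: "\<And>k. 1 \<le> k \<Longrightarrow> 0 \<le> \<psi> k"
    and sum_phi: "\<And>n. (\<Sum>k=1..n. real k * \<phi> k) \<le> F1"
    and sum_psi: "\<And>n. (\<Sum>k=1..n. \<psi> k) \<le> F2"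
    and mixed_moment: "\<And>i j k l. i < j \<Longrightarrow> j < k \<Longrightarrow> k < l \<Longrightarrow>
      \<bar>expectation (\<lambda>\<omega>. x i \<omega> * x j \<omega> * x k \<omega> * x l \<omega>)\<bar> \<le> Min {\<phi> (j - i), \<phi> (k - j), \<phi> (l - k)}"
    and covariance_squares: "\<And>i j. i < j \<Longrightarrow>
      covariance M (\<lambda>\<omega>. (x i \<omega>)\<^sup>2) (\<lambda>\<omega>. (x j \<omega>)\<^sup>2) \<le> \<psi> (j - i)"
begin

lemma F0_nonneg: "0 \<le> F0"
proof -
  have "0 \<le> expectation (\<lambda>\<omega>. x 0 \<omega> ^ 4)" by (intro integral_nonneg_AE) auto
  then show ?thesis using expectation_4[of 0] by linarith
qed

lemma F1_nonneg: "0 \<le> F1"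
  using sum_phi[of 0] by simp

lemma F2_nonneg: "0 \<le> F2"
  using sum_psi[of 0] by simp

lemma integrable_4 [simp]: "integrable M (\<lambda>\<omega>. x i \<omega> ^ 4)"
  using fourth_moment[of i] unfolding fourth_moment_def by simp

lemma fourth_moment_lin [simp]: "fourth_moment M (\<lambda>\<omega>. \<Sum>i<p. b i * x i \<omega>)"
  by (intro fourth_moment_sum) auto

lemma integrable_mult2 [simp]: "integrable M (\<lambda>\<omega>. (x i \<omega>)\<^sup>2 * (x j \<omega>)\<^sup>2)"
  by (intro fourth_moment_mult2) auto

lemma expectation_mult2: "expectation (\<lambda>\<omega>. (x i \<omega>)\<^sup>2 * (x j \<omega>)\<^sup>2) \<le> F0"
proof -
  have "expectation (\<lambda>\<omega>. (x i \<omega>)\<^sup>2 * (x j \<omega>)\<^sup>2) \<le> expectation (\<lambda>\<omega>. (x i \<omega> ^ 4 + x j \<omega> ^ 4) / 2)"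
  proof (rule integral_mono)
    show "(x i \<omega>)\<^sup>2 * (x j \<omega>)\<^sup>2 \<le> (x i \<omega> ^ 4 + x j \<omega> ^ 4) / 2" for \<omega>
      using sum_squares_bound[of "(x i \<omega>)\<^sup>2" "(x j \<omega>)\<^sup>2"] by simp
  qed auto
  also have "\<dots> = (expectation (\<lambda>\<omega>. x i \<omega> ^ 4) + expectation (\<lambda>\<omega>. x j \<omega> ^ 4)) / 2"
    by simp
  also have "\<dots> \<le> F0" using expectation_4[of i] expectation_4[of j] by simp
  finally show ?thesis .
qed

section \<open>Mixed moments with four distinct indices\<close>

definition mom :: "nat \<Rightarrow> nat \<Rightarrow> nat \<Rightarrow> nat \<Rightarrow> real" where
  "mom i j k l = expectation (\<lambda>\<omega>. x i \<omega> * x j \<omega> * x k \<omega> * x l \<omega>)"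

lemma mom_commute:
  "mom i j k l = mom j i k l" "mom i j k l = mom i k j l" "mom i j k l = mom i j l k"
  unfolding mom_def by (simp_all add: mult_ac)

text \<open>The argument is a pair of gap lengths, not of indices: two of the three gaps between
  four ordered indices.\<close>

definition gap :: "nat \<times> nat \<Rightarrow> real" where
  "gap s = min (\<phi> (fst s)) (\<phi> (snd s))"

text \<open>Discarding one of the three gaps leaves a minimum of two values, the form that
  \<open>sum_min_le\<close> can sum. Which gap to discard depends on where the summation indices
  lie.\<close>

lemma mom_le_gap:
  assumes "i < j" "j < k" "k < l"
  shows "\<bar>mom i j k l\<bar> \<le> gap (j - i, k - j)" "\<bar>mom i j k l\<bar> \<le> gap (k - j, l - k)"
    "\<bar>mom i j k l\<bar> \<le> gap (j - i, l - k)"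
  using mixed_moment[OF assms] by (auto simp: mom_def gap_def)

text \<open>The map \<open>h\<close> sends index pairs injectively to pairs of gaps, so the sum is
  dominated by that of \<open>gap\<close> over the whole square, which \<open>sum_min_le\<close>
  controls.\<close>

lemma sum_mom_le:
  assumes "inj_on h P" "h ` P \<subseteq> {1..p} \<times> {1..p}" "\<And>s. s \<in> P \<Longrightarrow> \<bar>mom i j (fst s) (snd s)\<bar> \<le> gap (h s)"
  shows "(\<Sum>s\<in>P. \<bar>mom i j (fst s) (snd s)\<bar>) \<le> 2 * F1"
proof -
  have "(\<Sum>s\<in>P. \<bar>mom i j (fst s) (snd s)\<bar>) \<le> (\<Sum>s\<in>P. gap (h s))"
    by (intro sum_mono assms)
  also have "\<dots> \<le> sum gap ({1..p} \<times> {1..p})"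
    by (intro sum_le_sum_reindex assms) (auto simp: gap_def phi_nonneg)
  also have "\<dots> = (\<Sum>a\<in>{1..p}. \<Sum>b\<in>{1..p}. min (\<phi> a) (\<phi> b))"
    by (simp add: sum.cartesian_product gap_def case_prod_beta)
  also have "\<dots> \<le> 2 * (\<Sum>k=1..p. real k * \<phi> k)" by (rule sum_min_le[OF phi_nonneg])
  also have "\<dots> \<le> 2 * F1" using sum_phi[of p] by simp
  finally show ?thesis .
qed

text \<open>Whatever the position of \<open>k < l\<close> relative to the fixed \<open>i < j\<close>, two of the three gaps
  determine \<open>(k, l)\<close>.\<close>

lemma sum_mom_ordered_le:
  assumes "i < j" "j < p"
  shows "(\<Sum>s\<in>{(k, l). k < l \<and> l < p \<and> distinct [i, j, k, l]}. \<bar>mom i j (fst s) (snd s)\<bar>) \<le> 12 * F1"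
proof -
  let ?w = "\<lambda>s. \<bar>mom i j (fst s) (snd s)\<bar>"
  let ?P1 = "{(k, l). j < k \<and> k < l \<and> l < p}" and ?P2 = "{(k, l). i < k \<and> k < j \<and> j < l \<and> l < p}"
  let ?P3 = "{(k, l). i < k \<and> k < l \<and> l < j}" and ?P4 = "{(k, l). k < i \<and> j < l \<and> l < p}"
  let ?P5 = "{(k, l). k < i \<and> i < l \<and> l < j}" and ?P6 = "{(k, l). k < l \<and> l < i}"
  have fin: "finite ?P1" "finite ?P2" "finite ?P3" "finite ?P4" "finite ?P5" "finite ?P6"
    by (rule finite_subset[of _ "{..<p} \<times> {..<p}"], (use assms in auto)[1], simp)+
  \<comment> \<open>Each equation sorts the indices for one of the positions \<open>?P2\<close> to
    \<open>?P6\<close>, in this order.\<close>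
  have perm: "mom i j k l = mom i k j l" "mom i j k l = mom i k l j" "mom i j k l = mom k i j l"
    "mom i j k l = mom k i l j" "mom i j k l = mom k l i j" for k l
    unfolding mom_def by (simp_all add: mult_ac)
  \<comment> \<open>To the right of \<open>j\<close> the last two gaps recover \<open>k\<close> and
    then \<open>l\<close>. The next four positions use the two outer gaps, and the position to the
    left of \<open>i\<close> uses the first two.\<close>
  have 1: "sum ?w ?P1 \<le> 2 * F1"
  proof (rule sum_mom_le[where h = "\<lambda>s. (fst s - j, snd s - fst s)" and p = p])
    show "\<bar>mom i j (fst s) (snd s)\<bar> \<le> gap (fst s - j, snd s - fst s)" if "s \<in> ?P1" for s
      using that assms mom_le_gap(2)[of i j "fst s" "snd s"] by auto
  qed (use assms in \<open>auto simp: inj_on_def\<close>)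
  have 2: "sum ?w ?P2 \<le> 2 * F1"
  proof (rule sum_mom_le[where h = "\<lambda>s. (fst s - i, snd s - j)" and p = p])
    show "\<bar>mom i j (fst s) (snd s)\<bar> \<le> gap (fst s - i, snd s - j)" if "s \<in> ?P2" for s
      using that assms mom_le_gap(3)[of i "fst s" j "snd s"] unfolding perm(1) by auto
  qed (use assms in \<open>auto simp: inj_on_def\<close>)
  have 3: "sum ?w ?P3 \<le> 2 * F1"
  proof (rule sum_mom_le[where h = "\<lambda>s. (fst s - i, j - snd s)" and p = p])
    show "\<bar>mom i j (fst s) (snd s)\<bar> \<le> gap (fst s - i, j - snd s)" if "s \<in> ?P3" for s
      using that assms mom_le_gap(3)[of i "fst s" "snd s" j] unfolding perm(2) by auto
  qed (use assms in \<open>auto simp: inj_on_def\<close>)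
  have 4: "sum ?w ?P4 \<le> 2 * F1"
  proof (rule sum_mom_le[where h = "\<lambda>s. (i - fst s, snd s - j)" and p = p])
    show "\<bar>mom i j (fst s) (snd s)\<bar> \<le> gap (i - fst s, snd s - j)" if "s \<in> ?P4" for s
      using that assms mom_le_gap(3)[of "fst s" i j "snd s"] unfolding perm(3) by auto
  qed (use assms in \<open>auto simp: inj_on_def\<close>)
  have 5: "sum ?w ?P5 \<le> 2 * F1"
  proof (rule sum_mom_le[where h = "\<lambda>s. (i - fst s, j - snd s)" and p = p])
    show "\<bar>mom i j (fst s) (snd s)\<bar> \<le> gap (i - fst s, j - snd s)" if "s \<in> ?P5" for s
      using that assms mom_le_gap(3)[of "fst s" i "snd s" j] unfolding perm(4) by auto
  qed (use assms in \<open>auto simp: inj_on_def\<close>)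
  have 6: "sum ?w ?P6 \<le> 2 * F1"
  proof (rule sum_mom_le[where h = "\<lambda>s. (snd s - fst s, i - snd s)" and p = p])
    show "\<bar>mom i j (fst s) (snd s)\<bar> \<le> gap (snd s - fst s, i - snd s)" if "s \<in> ?P6" for s
      using that assms mom_le_gap(1)[of "fst s" "snd s" i j] unfolding perm(5) by auto
  qed (use assms in \<open>auto simp: inj_on_def\<close>)
  \<comment> \<open>Subadditivity over unions, as the weights are nonnegative. The six positions
    then give \<open>12 = 6 * 2\<close>.\<close>
  have Un: "sum ?w (A \<union> B) \<le> sum ?w A + sum ?w B" if "finite A" "finite B" for A B
  proof -
    have "0 \<le> sum ?w (A \<inter> B)" by (intro sum_nonneg) simp
    then show ?thesis using sum.union_inter[OF that, of ?w] by linarith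
  qed
  have "(j < k \<and> k < l) \<or> (i < k \<and> k < j \<and> j < l) \<or> (i < k \<and> l < j) \<or> (k < i \<and> j < l)
      \<or> (k < i \<and> i < l \<and> l < j) \<or> l < i"
    if "k < l" "distinct [i, j, k, l]" for k l
    using that by simp linarith
  then have "{(k, l). k < l \<and> l < p \<and> distinct [i, j, k, l]} \<subseteq>
      ?P1 \<union> (?P2 \<union> (?P3 \<union> (?P4 \<union> (?P5 \<union> ?P6))))"
    by blast
  then have "(\<Sum>s\<in>{(k, l). k < l \<and> l < p \<and> distinct [i, j, k, l]}. ?w s) \<le>
      sum ?w (?P1 \<union> (?P2 \<union> (?P3 \<union> (?P4 \<union> (?P5 \<union> ?P6)))))"
    using fin by (intro sum_mono2) simp_all
  also have "\<dots> \<le> 2 * F1 + (2 * F1 + (2 * F1 + (2 * F1 + (2 * F1 + 2 * F1))))"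
    by (intro order_trans[OF Un] add_mono finite_UnI fin 1 2 3 4 5 6)
  finally show ?thesis by simp
qed

text \<open>Exchanging \<open>k\<close> and \<open>l\<close> costs a factor 2 over
  \<open>sum_mom_ordered_le\<close>. The case \<open>j < i\<close> follows by exchanging
  \<open>i\<close> and \<open>j\<close>.\<close>

lemma sum_mom_distinct_le:
  assumes "i < p" "j < p" "i \<noteq> j"
  shows "(\<Sum>k<p. \<Sum>l<p. if distinct [i, j, k, l] then \<bar>mom i j k l\<bar> else 0) \<le> 24 * F1"
proof -
  have *: "(\<Sum>k<p. \<Sum>l<p. if distinct [i, j, k, l] then \<bar>mom i j k l\<bar> else 0) \<le> 24 * F1"
    if "i < j" "j < p" for i j
  proof -
    let ?w = "\<lambda>s. \<bar>mom i j (fst s) (snd s)\<bar>"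
    let ?T = "{(k, l). k < l \<and> l < p \<and> distinct [i, j, k, l]}"
    have fin: "finite ?T"
      by (rule finite_subset[of _ "{..<p} \<times> {..<p}"]) auto
    have "(\<Sum>k<p. \<Sum>l<p. if distinct [i, j, k, l] then \<bar>mom i j k l\<bar> else 0)
        = (\<Sum>s\<in>{..<p} \<times> {..<p}. if distinct [i, j, fst s, snd s] then ?w s else 0)"
      by (simp add: sum.cartesian_product case_prod_beta)
    \<comment> \<open>Distinctness forces \<open>k \<noteq> l\<close>, so the support consists of
      the ordered pairs and their mirror images.\<close>
    also have "\<dots> = sum ?w (?T \<union> prod.swap ` ?T)"
      by (intro sum.mono_neutral_cong_right) (auto simp: image_iff)
    also have "\<dots> = sum ?w ?T + sum ?w (prod.swap ` ?T)"
      using fin by (intro sum.union_disjoint) auto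
    also have "sum ?w (prod.swap ` ?T) = sum ?w ?T"
      by (subst sum.reindex) (auto simp: mom_commute(3)[of i j] intro!: sum.cong)
    finally show ?thesis using sum_mom_ordered_le[OF that] by simp
  qed
  show ?thesis
  proof (cases "i < j")
    case False
    then have "j < i" using assms by simp
    moreover have "distinct [i, j, k, l] = distinct [j, i, k, l]" for k l by auto
    ultimately show ?thesis using *[of j i] assms by (simp only: mom_commute(1)[of i j])
  qed (use * assms in auto)
qed

section \<open>Expanding the square of an off-diagonal quadratic form\<close>

text \<open>The terms with four distinct indices form a quadratic form in the coefficients with
  kernel \<open>mom\<close>. Schur's test applies, as \<open>sum_mom_distinct_le\<close> bounds the
  absolute row sums by \<open>24 * F1\<close>. The terms with one coincidence are kept for a later
  estimate.\<close>

lemma expectation_square_quad_form: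
  assumes sym: "\<And>i j. B i j = B j i" and diag: "\<And>i. B i i = 0"
  shows "integrable M (\<lambda>\<omega>. (\<Sum>i<p. \<Sum>j<p. B i j * x i \<omega> * x j \<omega>)\<^sup>2)" (is "?int")
    and "expectation (\<lambda>\<omega>. (\<Sum>i<p. \<Sum>j<p. B i j * x i \<omega> * x j \<omega>)\<^sup>2) \<le>
      24 * F1 * (\<Sum>i<p. \<Sum>j<p. (B i j)\<^sup>2)
      + 4 * (\<Sum>i<p. expectation (\<lambda>\<omega>. (x i \<omega>)\<^sup>2 * (\<Sum>j<p. B i j * x j \<omega>)\<^sup>2))" (is "?le")
proof -
  define Q where "Q \<omega> = (\<Sum>i<p. \<Sum>j<p. B i j * x i \<omega> * x j \<omega>)" for \<omega>
  define D where "D \<omega> = (\<Sum>i<p. \<Sum>j<p. \<Sum>k<p. \<Sum>l<p.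
      if distinct [i, j, k, l] then B i j * B k l * (x i \<omega> * x j \<omega> * x k \<omega> * x l \<omega>) else 0)" for \<omega>
  define R where "R \<omega> = (\<Sum>i<p. (x i \<omega>)\<^sup>2 * (\<Sum>j<p. B i j * x j \<omega>)\<^sup>2)" for \<omega>
  define m where "m i j k l = (if distinct [i, j, k, l] then \<bar>mom i j k l\<bar> else 0)" for i j k l
  have Q2: "(Q \<omega>)\<^sup>2 = D \<omega> + 4 * R \<omega> - 2 * (\<Sum>i<p. \<Sum>j<p. (B i j)\<^sup>2 * (x i \<omega>)\<^sup>2 * (x j \<omega>)\<^sup>2)" for \<omega>
    unfolding Q_def D_def R_def by (rule square_quad_form[OF sym diag])
  have intT: "integrable M (\<lambda>\<omega>. if c then a * (x i \<omega> * x j \<omega> * x k \<omega> * x l \<omega>) else 0)" for c a i j k l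
    by (cases c) (auto intro!: fourth_moment_mult)
  have intD: "integrable M D"
    unfolding D_def by (intro Bochner_Integration.integrable_sum intT)
  have intR: "integrable M (\<lambda>\<omega>. (x i \<omega>)\<^sup>2 * (\<Sum>j<p. B i j * x j \<omega>)\<^sup>2)" for i
    by (intro fourth_moment_mult2) auto
  then have intR': "integrable M R"
    unfolding R_def by (intro Bochner_Integration.integrable_sum)
  have intQ: "integrable M (\<lambda>\<omega>. (Q \<omega>)\<^sup>2)"
    unfolding Q2 by (intro Bochner_Integration.integrable_diff Bochner_Integration.integrable_add intD intR'
        integrable_mult_right Bochner_Integration.integrable_sum) (simp add: mult.assoc)
  then show ?int unfolding Q_def .
  have "expectation D = (\<Sum>i<p. \<Sum>j<p. \<Sum>k<p. \<Sum>l<p.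
      expectation (\<lambda>\<omega>. if distinct [i, j, k, l] then B i j * B k l * (x i \<omega> * x j \<omega> * x k \<omega> * x l \<omega>) else 0))"
    unfolding D_def
    by (simp only: Bochner_Integration.integral_sum Bochner_Integration.integrable_sum intT)
  \<comment> \<open>Young's inequality for \<open>B i j * B k l\<close>. The second term is written
    with \<open>m k l i j\<close>, so that exchanging the pairs \<open>(i, j)\<close> and
    \<open>(k, l)\<close> turns its sum into the first.\<close>
  also have "\<dots> \<le> (\<Sum>i<p. \<Sum>j<p. \<Sum>k<p. \<Sum>l<p. (B i j)\<^sup>2 / 2 * m i j k l + (B k l)\<^sup>2 / 2 * m k l i j)"
  proof (intro sum_mono)
    fix i j k l
    have "B i j * B k l * mom i j k l \<le> \<bar>B i j * B k l\<bar> * \<bar>mom i j k l\<bar>"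
      by (metis abs_ge_self abs_mult)
    also have "\<dots> \<le> ((B i j)\<^sup>2 / 2 + (B k l)\<^sup>2 / 2) * \<bar>mom i j k l\<bar>"
      using sum_squares_bound[of "\<bar>B i j\<bar>" "\<bar>B k l\<bar>"] by (intro mult_right_mono) (auto simp: abs_mult)
    finally have "B i j * B k l * mom i j k l \<le> (B i j)\<^sup>2 / 2 * \<bar>mom i j k l\<bar> + (B k l)\<^sup>2 / 2 * \<bar>mom i j k l\<bar>"
      by (simp add: algebra_simps)
    moreover have "mom k l i j = mom i j k l" unfolding mom_def by (simp add: mult_ac)
    ultimately show "expectation (\<lambda>\<omega>. if distinct [i, j, k, l] then B i j * B k l * (x i \<omega> * x j \<omega> * x k \<omega> * x l \<omega>) else 0)
        \<le> (B i j)\<^sup>2 / 2 * m i j k l + (B k l)\<^sup>2 / 2 * m k l i j"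
      by (auto simp: m_def mom_def)
  qed
  also have "\<dots> = (\<Sum>i<p. \<Sum>j<p. \<Sum>k<p. \<Sum>l<p. (B i j)\<^sup>2 / 2 * m i j k l)
      + (\<Sum>i<p. \<Sum>j<p. \<Sum>k<p. \<Sum>l<p. (B k l)\<^sup>2 / 2 * m k l i j)"
    by (simp only: sum.distrib)
  also have "(\<Sum>i<p. \<Sum>j<p. \<Sum>k<p. \<Sum>l<p. (B k l)\<^sup>2 / 2 * m k l i j)
      = (\<Sum>i<p. \<Sum>j<p. \<Sum>k<p. \<Sum>l<p. (B i j)\<^sup>2 / 2 * m i j k l)"
    by (rule sum_swap_pairs)
  also have "(\<Sum>i<p. \<Sum>j<p. \<Sum>k<p. \<Sum>l<p. (B i j)\<^sup>2 / 2 * m i j k l)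
      = (\<Sum>i<p. \<Sum>j<p. (B i j)\<^sup>2 / 2 * (\<Sum>k<p. \<Sum>l<p. m i j k l))"
    by (simp only: sum_distrib_left)
  also have "\<dots> \<le> (\<Sum>i<p. \<Sum>j<p. (B i j)\<^sup>2 / 2 * (24 * F1))"
  proof (intro sum_mono)
    fix i j assume ij: "i \<in> {..<p}" "j \<in> {..<p}"
    show "(B i j)\<^sup>2 / 2 * (\<Sum>k<p. \<Sum>l<p. m i j k l) \<le> (B i j)\<^sup>2 / 2 * (24 * F1)"
    proof (cases "i = j")
      case False
      then have "(\<Sum>k<p. \<Sum>l<p. m i j k l) \<le> 24 * F1"
        using sum_mom_distinct_le[of i p j] ij unfolding m_def by simp
      then show ?thesis by (rule mult_left_mono) simp
    qed (simp add: diag)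
  qed
  finally have ED: "expectation D \<le> 24 * F1 * (\<Sum>i<p. \<Sum>j<p. (B i j)\<^sup>2)"
    by (simp add: sum_distrib_left sum_distrib_right mult_ac)
  \<comment> \<open>The double coincidences enter \<open>Q2\<close> with a negative sign and are
    dropped.\<close>
  have "expectation (\<lambda>\<omega>. (Q \<omega>)\<^sup>2) \<le> expectation (\<lambda>\<omega>. D \<omega> + 4 * R \<omega>)"
  proof (rule integral_mono)
    fix \<omega>
    have "0 \<le> (\<Sum>i<p. \<Sum>j<p. (B i j)\<^sup>2 * (x i \<omega>)\<^sup>2 * (x j \<omega>)\<^sup>2)"
      by (intro sum_nonneg) auto
    then show "(Q \<omega>)\<^sup>2 \<le> D \<omega> + 4 * R \<omega>"
      unfolding Q2 by linarith
  qed (use intQ intD intR' in auto)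
  also have "\<dots> = expectation D + 4 * expectation R"
    using intD intR' by simp
  also have "expectation R = (\<Sum>i<p. expectation (\<lambda>\<omega>. (x i \<omega>)\<^sup>2 * (\<Sum>j<p. B i j * x j \<omega>)\<^sup>2))"
    unfolding R_def by (intro Bochner_Integration.integral_sum intR)
  finally show ?le using ED unfolding Q_def by linarith
qed

section \<open>Fourth moments of linear forms\<close>

text \<open>With \<open>Y\<^sup>2 = Q + P\<close>, the bound for the second moment of
  \<open>Q\<close> involves the expectation of \<open>P * Y\<^sup>2\<close>. A weighted Young
  inequality trades the latter for half of the fourth moment of \<open>Y\<close>, which is finite
  and can be absorbed, and a multiple of the second moment of \<open>P\<close>.\<close>

lemma expectation_linear_4:
  "expectation (\<lambda>\<omega>. (\<Sum>i<p. b i * x i \<omega>) ^ 4) \<le> 292 * (F0 + F1) * (\<Sum>i<p. (b i)\<^sup>2)\<^sup>2"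
proof -
  define s where "s = (\<Sum>i<p. (b i)\<^sup>2)"
  define Y where "Y \<omega> = (\<Sum>i<p. b i * x i \<omega>)" for \<omega>
  define P where "P \<omega> = (\<Sum>i<p. (b i)\<^sup>2 * (x i \<omega>)\<^sup>2)" for \<omega>
  define B where "B i j = (if i = j then 0 else b i * b j)" for i j
  define Q where "Q \<omega> = (\<Sum>i<p. \<Sum>j<p. B i j * x i \<omega> * x j \<omega>)" for \<omega>
  have Y [simp]: "fourth_moment M Y"
    unfolding Y_def by simp
  have intY: "integrable M (\<lambda>\<omega>. Y \<omega> ^ 4)"
    using Y unfolding fourth_moment_def by simp
  have PY: "P \<omega> * (Y \<omega>)\<^sup>2 = (\<Sum>i<p. (b i)\<^sup>2 * ((x i \<omega>)\<^sup>2 * (Y \<omega>)\<^sup>2))" for \<omega>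
    unfolding P_def by (simp add: sum_distrib_right mult.assoc)
  have intPY: "integrable M (\<lambda>\<omega>. P \<omega> * (Y \<omega>)\<^sup>2)"
    unfolding PY by (intro Bochner_Integration.integrable_sum integrable_mult_right fourth_moment_mult2) auto
  have P2: "(P \<omega>)\<^sup>2 = (\<Sum>i<p. \<Sum>j<p. (b i)\<^sup>2 * (b j)\<^sup>2 * ((x i \<omega>)\<^sup>2 * (x j \<omega>)\<^sup>2))" for \<omega>
    unfolding P_def power2_eq_square[of "\<Sum>i<p. _ i"] by (simp add: sum_product mult_ac)
  have intP2: "integrable M (\<lambda>\<omega>. (P \<omega>)\<^sup>2)"
    unfolding P2 by (intro Bochner_Integration.integrable_sum integrable_mult_right) auto
  have s2: "s\<^sup>2 = (\<Sum>i<p. \<Sum>j<p. (b i)\<^sup>2 * (b j)\<^sup>2)"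
    unfolding s_def power2_eq_square[of "\<Sum>i<p. _ i"] by (simp add: sum_product)
  have "expectation (\<lambda>\<omega>. (P \<omega>)\<^sup>2) = (\<Sum>i<p. \<Sum>j<p. (b i)\<^sup>2 * (b j)\<^sup>2 * expectation (\<lambda>\<omega>. (x i \<omega>)\<^sup>2 * (x j \<omega>)\<^sup>2))"
    unfolding P2 by simp
  also have "\<dots> \<le> (\<Sum>i<p. \<Sum>j<p. (b i)\<^sup>2 * (b j)\<^sup>2 * F0)"
    by (intro sum_mono mult_left_mono expectation_mult2) auto
  also have "\<dots> = F0 * s\<^sup>2"
    unfolding s2 by (simp add: sum_distrib_left mult_ac)
  finally have EP2: "expectation (\<lambda>\<omega>. (P \<omega>)\<^sup>2) \<le> F0 * s\<^sup>2" .
  have B2: "(\<Sum>i<p. \<Sum>j<p. (B i j)\<^sup>2) \<le> s\<^sup>2"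
    unfolding s2 by (intro sum_mono) (auto simp: B_def power_mult_distrib)
  \<comment> \<open>Row \<open>i\<close> of \<open>B\<close> omits the index \<open>i\<close>, so
    its linear form is \<open>Y\<close> without the term of index \<open>i\<close>, scaled by
    \<open>b i\<close>.\<close>
  have Yi: "(\<Sum>j<p. B i j * x j \<omega>) = b i * (Y \<omega> - b i * x i \<omega>)" if "i < p" for i \<omega>
  proof -
    have "(\<Sum>j<p. B i j * x j \<omega>) = (\<Sum>j<p. b i * (b j * x j \<omega>) - (if j = i then b i * (b i * x i \<omega>) else 0))"
      by (intro sum.cong) (auto simp: B_def)
    also have "\<dots> = b i * Y \<omega> - b i * (b i * x i \<omega>)"
      using that by (simp add: sum_subtractf Y_def sum_distrib_left)
    finally show ?thesis by (simp add: algebra_simps)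
  qed
  have Q: "Q \<omega> = (Y \<omega>)\<^sup>2 - P \<omega>" for \<omega>
  proof -
    have "Q \<omega> = (\<Sum>i<p. x i \<omega> * (\<Sum>j<p. B i j * x j \<omega>))"
      unfolding Q_def by (simp add: sum_distrib_left mult_ac)
    also have "\<dots> = (\<Sum>i<p. b i * x i \<omega> * Y \<omega> - (b i)\<^sup>2 * (x i \<omega>)\<^sup>2)"
      by (intro sum.cong) (auto simp: Yi power2_eq_square algebra_simps)
    also have "\<dots> = (Y \<omega>)\<^sup>2 - P \<omega>"
      by (simp add: sum_subtractf Y_def P_def power2_eq_square sum_distrib_right)
    finally show ?thesis .
  qed
  have intQ: "integrable M (\<lambda>\<omega>. (Q \<omega>)\<^sup>2)" and EQ: "expectation (\<lambda>\<omega>. (Q \<omega>)\<^sup>2) \<le>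
      24 * F1 * (\<Sum>i<p. \<Sum>j<p. (B i j)\<^sup>2)
      + 4 * (\<Sum>i<p. expectation (\<lambda>\<omega>. (x i \<omega>)\<^sup>2 * (\<Sum>j<p. B i j * x j \<omega>)\<^sup>2))"
    unfolding Q_def by (rule expectation_square_quad_form; simp add: B_def)+
  have "(\<Sum>i<p. expectation (\<lambda>\<omega>. (x i \<omega>)\<^sup>2 * (\<Sum>j<p. B i j * x j \<omega>)\<^sup>2))
      = expectation (\<lambda>\<omega>. \<Sum>i<p. (x i \<omega>)\<^sup>2 * (\<Sum>j<p. B i j * x j \<omega>)\<^sup>2)"
    by (intro Bochner_Integration.integral_sum[symmetric] fourth_moment_mult2) auto
  \<comment> \<open>Each summand uses
    \<open>(u - v)\<^sup>2 \<le> 2 * u\<^sup>2 + 2 * v\<^sup>2\<close>. The remaining sum of squares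
    of nonnegative terms is at most the square of their sum \<open>P \<omega>\<close>.\<close>
  also have "\<dots> \<le> expectation (\<lambda>\<omega>. 2 * (P \<omega> * (Y \<omega>)\<^sup>2) + 2 * (P \<omega>)\<^sup>2)"
  proof (rule integral_mono)
    show "integrable M (\<lambda>\<omega>. \<Sum>i<p. (x i \<omega>)\<^sup>2 * (\<Sum>j<p. B i j * x j \<omega>)\<^sup>2)"
      by (intro Bochner_Integration.integrable_sum fourth_moment_mult2) auto
    fix \<omega>
    have "(\<Sum>i<p. (x i \<omega>)\<^sup>2 * (\<Sum>j<p. B i j * x j \<omega>)\<^sup>2)
        \<le> (\<Sum>i<p. 2 * ((b i)\<^sup>2 * ((x i \<omega>)\<^sup>2 * (Y \<omega>)\<^sup>2)) + 2 * ((b i)\<^sup>2 * (x i \<omega>)\<^sup>2)\<^sup>2)"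
    proof (intro sum_mono)
      fix i assume "i \<in> {..<p}"
      then have "(x i \<omega>)\<^sup>2 * (\<Sum>j<p. B i j * x j \<omega>)\<^sup>2 = (b i * x i \<omega>)\<^sup>2 * (Y \<omega> - b i * x i \<omega>)\<^sup>2"
        by (simp add: Yi power_mult_distrib mult_ac)
      also have "\<dots> \<le> (b i * x i \<omega>)\<^sup>2 * (2 * (Y \<omega>)\<^sup>2 + 2 * (b i * x i \<omega>)\<^sup>2)"
      proof (rule mult_left_mono)
        show "(Y \<omega> - b i * x i \<omega>)\<^sup>2 \<le> 2 * (Y \<omega>)\<^sup>2 + 2 * (b i * x i \<omega>)\<^sup>2"
          using zero_le_power2[of "Y \<omega> + b i * x i \<omega>"] unfolding power2_sum power2_diff by linarith
      qed simp
      also have "\<dots> = 2 * ((b i)\<^sup>2 * ((x i \<omega>)\<^sup>2 * (Y \<omega>)\<^sup>2)) + 2 * ((b i)\<^sup>2 * (x i \<omega>)\<^sup>2)\<^sup>2"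
        by (simp add: power2_eq_square algebra_simps)
      finally show "(x i \<omega>)\<^sup>2 * (\<Sum>j<p. B i j * x j \<omega>)\<^sup>2
        \<le> 2 * ((b i)\<^sup>2 * ((x i \<omega>)\<^sup>2 * (Y \<omega>)\<^sup>2)) + 2 * ((b i)\<^sup>2 * (x i \<omega>)\<^sup>2)\<^sup>2" .
    qed
    also have "\<dots> = 2 * (P \<omega> * (Y \<omega>)\<^sup>2) + 2 * (\<Sum>i<p. ((b i)\<^sup>2 * (x i \<omega>)\<^sup>2)\<^sup>2)"
      unfolding PY by (simp only: sum.distrib sum_distrib_left)
    also have "(\<Sum>i<p. ((b i)\<^sup>2 * (x i \<omega>)\<^sup>2)\<^sup>2) \<le> (P \<omega>)\<^sup>2"
      unfolding P_def by (rule sum_power2_le) auto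
    finally show "(\<Sum>i<p. (x i \<omega>)\<^sup>2 * (\<Sum>j<p. B i j * x j \<omega>)\<^sup>2) \<le> 2 * (P \<omega> * (Y \<omega>)\<^sup>2) + 2 * (P \<omega>)\<^sup>2"
      by simp
  qed (use intPY intP2 in auto)
  also have "\<dots> = 2 * expectation (\<lambda>\<omega>. P \<omega> * (Y \<omega>)\<^sup>2) + 2 * expectation (\<lambda>\<omega>. (P \<omega>)\<^sup>2)"
    using intPY intP2 by simp
  finally have EQ': "expectation (\<lambda>\<omega>. (Q \<omega>)\<^sup>2) \<le> 24 * F1 * s\<^sup>2 +
      8 * expectation (\<lambda>\<omega>. P \<omega> * (Y \<omega>)\<^sup>2) + 8 * expectation (\<lambda>\<omega>. (P \<omega>)\<^sup>2)"
    using EQ mult_left_mono[OF B2, of "24 * F1"] F1_nonneg by linarith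
  have "expectation (\<lambda>\<omega>. Y \<omega> ^ 4) \<le> expectation (\<lambda>\<omega>. 2 * (Q \<omega>)\<^sup>2 + 2 * (P \<omega>)\<^sup>2)"
  proof (rule integral_mono)
    have "u\<^sup>2 \<le> 2 * (u - v)\<^sup>2 + 2 * v\<^sup>2" for u v :: real
      using zero_le_power2[of "u - 2 * v"] by (simp add: power2_eq_square algebra_simps)
    from this[of "(Y _)\<^sup>2" "P _"] show "Y \<omega> ^ 4 \<le> 2 * (Q \<omega>)\<^sup>2 + 2 * (P \<omega>)\<^sup>2" for \<omega>
      unfolding Q by simp
  qed (use intY intQ intP2 in auto)
  also have "\<dots> = 2 * expectation (\<lambda>\<omega>. (Q \<omega>)\<^sup>2) + 2 * expectation (\<lambda>\<omega>. (P \<omega>)\<^sup>2)"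
    using intQ intP2 by simp
  finally have EY: "expectation (\<lambda>\<omega>. Y \<omega> ^ 4) \<le> 2 * expectation (\<lambda>\<omega>. (Q \<omega>)\<^sup>2) + 2 * expectation (\<lambda>\<omega>. (P \<omega>)\<^sup>2)" .
  \<comment> \<open>Inserting \<open>EQ'\<close> into \<open>EY\<close> produces
    \<open>P * Y\<^sup>2\<close> with the factor 16. The weights are chosen so that exactly half of
    the fourth moment of \<open>Y\<close> appears on the right.\<close>
  have "expectation (\<lambda>\<omega>. 16 * (P \<omega> * (Y \<omega>)\<^sup>2)) \<le> expectation (\<lambda>\<omega>. Y \<omega> ^ 4 / 2 + 128 * (P \<omega>)\<^sup>2)"
  proof (rule integral_mono)
    have "16 * (v * u) \<le> u\<^sup>2 / 2 + 128 * v\<^sup>2" for u v :: real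
      using zero_le_power2[of "u - 16 * v"] by (simp add: power2_eq_square algebra_simps)
    from this[of "P _" "(Y _)\<^sup>2"] show "16 * (P \<omega> * (Y \<omega>)\<^sup>2) \<le> Y \<omega> ^ 4 / 2 + 128 * (P \<omega>)\<^sup>2" for \<omega>
      by simp
  qed (use intPY intY intP2 in auto)
  then have "16 * expectation (\<lambda>\<omega>. P \<omega> * (Y \<omega>)\<^sup>2) \<le> expectation (\<lambda>\<omega>. Y \<omega> ^ 4) / 2 + 128 * expectation (\<lambda>\<omega>. (P \<omega>)\<^sup>2)"
    using intPY intY intP2 by simp
  \<comment> \<open>Moving that half to the left and doubling the rest gives
    \<open>96 = 2 * (2 * 24)\<close> and \<open>292 = 2 * (2 * 8 + 2 + 128)\<close>.\<close>
  then have "expectation (\<lambda>\<omega>. Y \<omega> ^ 4) \<le> 96 * (F1 * s\<^sup>2) + 292 * (F0 * s\<^sup>2)"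
    using EY EQ' EP2 by linarith
  also have "\<dots> \<le> 292 * (F0 + F1) * s\<^sup>2"
    using F1_nonneg by (simp add: algebra_simps)
  finally show ?thesis unfolding Y_def s_def .
qed

section \<open>The off-diagonal part\<close>

text \<open>Each row of \<open>B\<close> defines a linear form whose fourth moment is at most a
  multiple of \<open>s\<^sup>2\<close>, where \<open>s\<close> is the sum of squares of the row.
  Young's inequality with weight \<open>s\<close> makes both resulting terms linear in
  \<open>s\<close>, so that the rows add up.\<close>

lemma expectation_square_offdiag:
  assumes sym: "\<And>i j. B i j = B j i" and diag: "\<And>i. B i i = 0"
  shows "expectation (\<lambda>\<omega>. (\<Sum>i<p. \<Sum>j<p. B i j * x i \<omega> * x j \<omega>)\<^sup>2) \<le>
      612 * (F0 + F1) * (\<Sum>i<p. \<Sum>j<p. (B i j)\<^sup>2)"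
proof -
  have row: "expectation (\<lambda>\<omega>. (x i \<omega>)\<^sup>2 * (\<Sum>j<p. B i j * x j \<omega>)\<^sup>2) \<le> 147 * (F0 + F1) * (\<Sum>j<p. (B i j)\<^sup>2)" for i
  \<comment> \<open>A zero row is treated separately because the other case divides by
    \<open>s\<close>.\<close>
  proof (cases "(\<Sum>j<p. (B i j)\<^sup>2) = 0")
    case True
    then show ?thesis by (simp add: sum_nonneg_eq_0_iff)
  next
    case False
    define s where "s = (\<Sum>j<p. (B i j)\<^sup>2)"
    define Y where "Y \<omega> = (\<Sum>j<p. B i j * x j \<omega>)" for \<omega>
    have s: "s > 0" using False sum_nonneg[of "{..<p}" "\<lambda>j. (B i j)\<^sup>2"] by (simp add: s_def less_le)
    have Y [simp]: "fourth_moment M Y"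
      unfolding Y_def by simp
    have intY: "integrable M (\<lambda>\<omega>. Y \<omega> ^ 4)"
      using Y unfolding fourth_moment_def by simp
    have "expectation (\<lambda>\<omega>. (x i \<omega>)\<^sup>2 * (Y \<omega>)\<^sup>2) \<le> expectation (\<lambda>\<omega>. s / 2 * x i \<omega> ^ 4 + 1 / (2 * s) * Y \<omega> ^ 4)"
    proof (rule integral_mono)
      fix \<omega>
      have "2 * (s * (x i \<omega>)\<^sup>2) * (Y \<omega>)\<^sup>2 \<le> (s * (x i \<omega>)\<^sup>2)\<^sup>2 + ((Y \<omega>)\<^sup>2)\<^sup>2"
        by (rule sum_squares_bound)
      then show "(x i \<omega>)\<^sup>2 * (Y \<omega>)\<^sup>2 \<le> s / 2 * x i \<omega> ^ 4 + 1 / (2 * s) * Y \<omega> ^ 4"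
        using s by (simp add: field_simps power2_eq_square power4_eq_xxxx)
    qed (use intY in \<open>auto intro!: fourth_moment_mult2\<close>)
    also have "\<dots> = s / 2 * expectation (\<lambda>\<omega>. x i \<omega> ^ 4) + 1 / (2 * s) * expectation (\<lambda>\<omega>. Y \<omega> ^ 4)"
      using intY by simp
    also have "\<dots> \<le> s / 2 * F0 + 1 / (2 * s) * (292 * (F0 + F1) * s\<^sup>2)"
      using s expectation_linear_4[of "B i" p] unfolding Y_def s_def
      by (intro add_mono mult_left_mono expectation_4) auto
    also have "\<dots> = s / 2 * F0 + 146 * (F0 + F1) * s"
      using s by (simp add: power2_eq_square)
    also have "\<dots> \<le> 147 * (F0 + F1) * s"
      using s F0_nonneg F1_nonneg by (simp add: algebra_simps)
    finally show ?thesis unfolding Y_def s_def .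
  qed
  have "expectation (\<lambda>\<omega>. (\<Sum>i<p. \<Sum>j<p. B i j * x i \<omega> * x j \<omega>)\<^sup>2) \<le> 24 * F1 * (\<Sum>i<p. \<Sum>j<p. (B i j)\<^sup>2)
      + 4 * (\<Sum>i<p. expectation (\<lambda>\<omega>. (x i \<omega>)\<^sup>2 * (\<Sum>j<p. B i j * x j \<omega>)\<^sup>2))"
    by (rule expectation_square_quad_form[OF assms])
  also have "\<dots> \<le> 24 * F1 * (\<Sum>i<p. \<Sum>j<p. (B i j)\<^sup>2) + 4 * (\<Sum>i<p. 147 * (F0 + F1) * (\<Sum>j<p. (B i j)\<^sup>2))"
    by (intro add_left_mono mult_left_mono sum_mono row) auto
  \<comment> \<open>Here \<open>588 = 4 * 147\<close> and \<open>612 = 588 + 24\<close>; the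
    constant 147 rounds up \<open>146 + 1 / 2\<close>.\<close>
  also have "\<dots> = (588 * F0 + 612 * F1) * (\<Sum>i<p. \<Sum>j<p. (B i j)\<^sup>2)"
    unfolding sum_distrib_left[symmetric] by (simp add: algebra_simps)
  also have "\<dots> \<le> 612 * (F0 + F1) * (\<Sum>i<p. \<Sum>j<p. (B i j)\<^sup>2)"
    using F0_nonneg by (intro mult_right_mono sum_nonneg) auto
  finally show ?thesis .
qed

section \<open>The diagonal part\<close>

text \<open>The covariances are bounded from above only. As the quadratic form \<open>c\<close> they define is
  nonnegative at \<open>\<bar>a\<bar>\<close>, its value at \<open>a\<close> is at most \<open>\<Sum> c\<^sub>i\<^sub>j (a\<^sub>i a\<^sub>j + \<bar>a\<^sub>i a\<^sub>j\<bar>)\<close>, whose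
  coefficients of the \<open>c\<^sub>i\<^sub>j\<close> are nonnegative.\<close>

lemma expectation_square_diag:
  defines "m \<equiv> \<lambda>i. expectation (\<lambda>\<omega>. (x i \<omega>)\<^sup>2)"
  shows "integrable M (\<lambda>\<omega>. (\<Sum>i<p. a i * ((x i \<omega>)\<^sup>2 - m i))\<^sup>2)" (is ?int)
    and "expectation (\<lambda>\<omega>. (\<Sum>i<p. a i * ((x i \<omega>)\<^sup>2 - m i))\<^sup>2) \<le> 2 * (F0 + 2 * F2) * (\<Sum>i<p. (a i)\<^sup>2)" (is ?le)
proof -
  define y where "y i \<omega> = (x i \<omega>)\<^sup>2 - m i" for i \<omega>
  define c where "c i j = expectation (\<lambda>\<omega>. y i \<omega> * y j \<omega>)" for i j
  \<comment> \<open>A nonnegative symmetric majorant of \<open>c\<close>; the covariance assumption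
    speaks of \<open>i < j\<close>, and symmetry of \<open>c\<close> supplies
    \<open>j < i\<close>.\<close>
  define d where "d i j = (if i = j then F0 else if i < j then \<psi> (j - i) else \<psi> (i - j))" for i j
  have meas: "x i \<in> borel_measurable M" for i
    using fourth_moment[of i] unfolding fourth_moment_def by simp
  have int2: "integrable M (\<lambda>\<omega>. (x i \<omega>)\<^sup>2)" for i
    by (rule square_integrable_imp_integrable) (use meas in auto)
  have inty: "integrable M (\<lambda>\<omega>. y i \<omega> * y j \<omega>)" for i j
  proof -
    have "(\<lambda>\<omega>. y i \<omega> * y j \<omega>) = (\<lambda>\<omega>. (x i \<omega>)\<^sup>2 * (x j \<omega>)\<^sup>2 - m i * (x j \<omega>)\<^sup>2 - m j * (x i \<omega>)\<^sup>2 + m i * m j)"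
      by (simp add: y_def algebra_simps)
    then show ?thesis using int2 by simp
  qed
  have sq: "(\<Sum>i<p. b i * y i \<omega>)\<^sup>2 = (\<Sum>i<p. \<Sum>j<p. b i * b j * (y i \<omega> * y j \<omega>))" for b \<omega>
    by (simp add: power2_eq_square sum_product mult_ac)
  have int: "integrable M (\<lambda>\<omega>. (\<Sum>i<p. b i * y i \<omega>)\<^sup>2)" for b
    unfolding sq by (intro Bochner_Integration.integrable_sum integrable_mult_right inty)
  then show ?int unfolding y_def .
  have E: "expectation (\<lambda>\<omega>. (\<Sum>i<p. b i * y i \<omega>)\<^sup>2) = (\<Sum>i<p. \<Sum>j<p. b i * b j * c i j)" for b
    unfolding sq c_def by (simp add: inty)
  have c_sym: "c i j = c j i" for i j
    unfolding c_def by (simp add: mult.commute)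
  have c_less: "c i j \<le> \<psi> (j - i)" if "i < j" for i j
    using covariance_squares[OF that] unfolding covariance_def c_def y_def m_def .
  \<comment> \<open>On the diagonal \<open>c\<close> is the variance of the square, at most the
    fourth moment of \<open>x i\<close>.\<close>
  have c_diag: "c i i \<le> F0" for i
  proof -
    have "c i i = variance (\<lambda>\<omega>. (x i \<omega>)\<^sup>2)"
      unfolding c_def y_def m_def power2_eq_square ..
    also have "\<dots> = expectation (\<lambda>\<omega>. ((x i \<omega>)\<^sup>2)\<^sup>2) - (m i)\<^sup>2"
      unfolding m_def using int2 by (intro variance_eq) auto
    also have "\<dots> \<le> F0" by (rule order_trans[OF _ expectation_4[of i]]) simp
    finally show ?thesis .
  qed
  have c_le: "c i j \<le> d i j" for i j
    using c_less[of i j] c_less[of j i] c_diag[of i] c_sym[of i j] by (auto simp: d_def)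
  have d_nonneg: "0 \<le> d i j" for i j
    using F0_nonneg psi_nonneg by (auto simp: d_def)
  have d_sym: "d i j = d j i" for i j
    by (auto simp: d_def)
  \<comment> \<open>On each side of \<open>i\<close> every gap occurs at most once, so each side
    contributes at most \<open>F2\<close>.\<close>
  have d_row: "(\<Sum>j<p. d i j) \<le> F0 + 2 * F2" if "i < p" for i
  proof -
    have part: "(\<Sum>j\<in>J. \<psi> (h j)) \<le> F2" if "inj_on h J" "h ` J \<subseteq> {1..p}" for h J
    proof -
      have "(\<Sum>j\<in>J. \<psi> (h j)) \<le> sum \<psi> {1..p}"
        using that by (intro sum_le_sum_reindex) (auto simp: psi_nonneg)
      then show ?thesis using sum_psi[of p] by linarith
    qed
    have "{..<p} = {i} \<union> ({..<i} \<union> {i<..<p})" using that by auto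
    then have "(\<Sum>j<p. d i j) = (\<Sum>j\<in>{i} \<union> ({..<i} \<union> {i<..<p}). d i j)" by simp
    also have "\<dots> = d i i + ((\<Sum>j<i. d i j) + (\<Sum>j\<in>{i<..<p}. d i j))"
      by (subst sum.union_disjoint, simp, simp, force, subst sum.union_disjoint) auto
    also have "(\<Sum>j<i. d i j) = (\<Sum>j<i. \<psi> (i - j))" by (intro sum.cong) (auto simp: d_def)
    also have "\<dots> \<le> F2" using that by (intro part) (auto simp: inj_on_def)
    also have "(\<Sum>j\<in>{i<..<p}. d i j) = (\<Sum>j\<in>{i<..<p}. \<psi> (j - i))" by (intro sum.cong) (auto simp: d_def)
    also have "\<dots> \<le> F2" using that by (intro part) (auto simp: inj_on_def)
    finally show ?thesis by (simp add: d_def)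
  qed
  have "0 \<le> expectation (\<lambda>\<omega>. (\<Sum>i<p. \<bar>a i\<bar> * y i \<omega>)\<^sup>2)" by simp
  then have "expectation (\<lambda>\<omega>. (\<Sum>i<p. a i * y i \<omega>)\<^sup>2)
      \<le> (\<Sum>i<p. \<Sum>j<p. a i * a j * c i j) + (\<Sum>i<p. \<Sum>j<p. \<bar>a i\<bar> * \<bar>a j\<bar> * c i j)"
    unfolding E by simp
  also have "\<dots> = (\<Sum>i<p. \<Sum>j<p. (a i * a j + \<bar>a i * a j\<bar>) * c i j)"
    by (simp add: sum.distrib[symmetric] abs_mult algebra_simps)
  \<comment> \<open>Schur's test again: the coefficient is at most
    \<open>(a i)\<^sup>2 + (a j)\<^sup>2\<close>, and writing \<open>d j i\<close> in the second
    term makes its sum the first one with the indices exchanged.\<close>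
  also have "\<dots> \<le> (\<Sum>i<p. \<Sum>j<p. (a i)\<^sup>2 * d i j + (a j)\<^sup>2 * d j i)"
  proof (intro sum_mono)
    fix i j
    have "(a i * a j + \<bar>a i * a j\<bar>) * c i j \<le> (a i * a j + \<bar>a i * a j\<bar>) * d i j"
      by (intro mult_left_mono c_le) auto
    also have "\<dots> \<le> ((a i)\<^sup>2 + (a j)\<^sup>2) * d i j"
      using sum_squares_bound[of "a i" "a j"]
      by (intro mult_right_mono d_nonneg) (auto simp: abs_if)
    finally show "(a i * a j + \<bar>a i * a j\<bar>) * c i j \<le> (a i)\<^sup>2 * d i j + (a j)\<^sup>2 * d j i"
      by (simp add: algebra_simps d_sym)
  qed
  also have "\<dots> = (\<Sum>i<p. \<Sum>j<p. (a i)\<^sup>2 * d i j) + (\<Sum>i<p. \<Sum>j<p. (a j)\<^sup>2 * d j i)"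
    by (simp only: sum.distrib)
  also have "(\<Sum>i<p. \<Sum>j<p. (a j)\<^sup>2 * d j i) = (\<Sum>i<p. \<Sum>j<p. (a i)\<^sup>2 * d i j)"
    by (rule sum.swap)
  also have "(\<Sum>i<p. \<Sum>j<p. (a i)\<^sup>2 * d i j) = (\<Sum>i<p. (a i)\<^sup>2 * (\<Sum>j<p. d i j))"
    by (simp only: sum_distrib_left)
  also have "\<dots> \<le> (\<Sum>i<p. (a i)\<^sup>2 * (F0 + 2 * F2))"
    by (intro sum_mono mult_left_mono d_row) auto
  also have "\<dots> = (F0 + 2 * F2) * (\<Sum>i<p. (a i)\<^sup>2)"
    by (simp add: sum_distrib_right[symmetric] mult.commute)
  finally show ?le unfolding y_def by (simp add: algebra_simps)
qed

section \<open>The full quadratic form\<close>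

text \<open>Symmetrizing the off-diagonal entries leaves the form unchanged and does not increase
  their sum of squares. As \<open>(D + Q)\<^sup>2 \<le> 2 * D\<^sup>2 + 2 * Q\<^sup>2\<close>, no
  joint moments of \<open>D\<close> and \<open>Q\<close> have to be estimated.\<close>

lemma quad_form_deviation:
  defines "m \<equiv> \<lambda>i. expectation (\<lambda>\<omega>. (x i \<omega>)\<^sup>2)"
  shows "integrable M (\<lambda>\<omega>. ((\<Sum>i<p. \<Sum>j<p. A i j * x i \<omega> * x j \<omega>) - (\<Sum>i<p. A i i * m i))\<^sup>2)" (is ?int)
    and "expectation (\<lambda>\<omega>. ((\<Sum>i<p. \<Sum>j<p. A i j * x i \<omega> * x j \<omega>) - (\<Sum>i<p. A i i * m i))\<^sup>2)
      \<le> 1228 * (F0 + F1 + F2) * (\<Sum>i<p. \<Sum>j<p. (A i j)\<^sup>2)" (is ?le)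
proof -
  define B where "B i j = (if i = j then 0 else (A i j + A j i) / 2)" for i j
  define Q where "Q \<omega> = (\<Sum>i<p. \<Sum>j<p. B i j * x i \<omega> * x j \<omega>)" for \<omega>
  define D where "D \<omega> = (\<Sum>i<p. A i i * ((x i \<omega>)\<^sup>2 - m i))" for \<omega>
  define S where "S = (\<Sum>i<p. \<Sum>j<p. (A i j)\<^sup>2)"
  have B: "B i j = B j i" "B i i = 0" for i j
    by (auto simp: B_def)
  have intQ: "integrable M (\<lambda>\<omega>. (Q \<omega>)\<^sup>2)"
    unfolding Q_def by (rule expectation_square_quad_form[where B = B, OF B])
  have intD: "integrable M (\<lambda>\<omega>. (D \<omega>)\<^sup>2)"
    unfolding D_def m_def by (rule expectation_square_diag)
  have meas: "Q \<in> borel_measurable M" "D \<in> borel_measurable M"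
    using fourth_moment unfolding fourth_moment_def Q_def D_def
    by (auto intro!: borel_measurable_sum borel_measurable_times borel_measurable_diff borel_measurable_power)
  have eq: "(\<Sum>i<p. \<Sum>j<p. A i j * x i \<omega> * x j \<omega>) - (\<Sum>i<p. A i i * m i) = D \<omega> + Q \<omega>" for \<omega>
  proof -
    \<comment> \<open>The form is added to its transpose; the conditional term below restores the
      diagonal, which \<open>B\<close> lacks.\<close>
    have "2 * (\<Sum>i<p. \<Sum>j<p. A i j * x i \<omega> * x j \<omega>)
        = (\<Sum>i<p. \<Sum>j<p. A i j * x i \<omega> * x j \<omega>) + (\<Sum>i<p. \<Sum>j<p. A j i * x j \<omega> * x i \<omega>)"
      using sum.swap[of "\<lambda>i j. A i j * x i \<omega> * x j \<omega>" "{..<p}" "{..<p}"] by simp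
    also have "\<dots> = (\<Sum>i<p. \<Sum>j<p. 2 * (B i j * x i \<omega> * x j \<omega>) + (if i = j then 2 * (A i i * (x i \<omega>)\<^sup>2) else 0))"
      unfolding sum.distrib[symmetric]
      by (intro sum.cong refl) (auto simp: B_def power2_eq_square algebra_simps)
    also have "\<dots> = 2 * Q \<omega> + 2 * (\<Sum>i<p. A i i * (x i \<omega>)\<^sup>2)"
      by (simp add: sum.distrib Q_def sum_distrib_left)
    finally show ?thesis
      by (simp add: D_def sum_subtractf algebra_simps)
  qed
  have le: "(D \<omega> + Q \<omega>)\<^sup>2 \<le> 2 * (D \<omega>)\<^sup>2 + 2 * (Q \<omega>)\<^sup>2" for \<omega>
    using zero_le_power2[of "D \<omega> - Q \<omega>"] unfolding power2_sum power2_diff by linarith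
  have int: "integrable M (\<lambda>\<omega>. (D \<omega> + Q \<omega>)\<^sup>2)"
  proof (rule Bochner_Integration.integrable_bound)
    show "integrable M (\<lambda>\<omega>. 2 * (D \<omega>)\<^sup>2 + 2 * (Q \<omega>)\<^sup>2)" using intD intQ by simp
    show "AE \<omega> in M. norm ((D \<omega> + Q \<omega>)\<^sup>2) \<le> norm (2 * (D \<omega>)\<^sup>2 + 2 * (Q \<omega>)\<^sup>2)"
      using le by simp
  qed (use meas in measurable)
  then show ?int unfolding eq .
  have "expectation (\<lambda>\<omega>. (D \<omega> + Q \<omega>)\<^sup>2) \<le> expectation (\<lambda>\<omega>. 2 * (D \<omega>)\<^sup>2 + 2 * (Q \<omega>)\<^sup>2)"
    by (rule integral_mono) (use int intD intQ le in auto)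
  also have "\<dots> = 2 * expectation (\<lambda>\<omega>. (D \<omega>)\<^sup>2) + 2 * expectation (\<lambda>\<omega>. (Q \<omega>)\<^sup>2)"
    using intD intQ by simp
  also have "\<dots> \<le> 2 * (2 * (F0 + 2 * F2) * S) + 2 * (612 * (F0 + F1) * S)"
  proof (intro add_mono mult_left_mono)
    have "(A i i)\<^sup>2 \<le> (\<Sum>j<p. (A i j)\<^sup>2)" if "i < p" for i
      using that by (intro member_le_sum) auto
    then have "(\<Sum>i<p. (A i i)\<^sup>2) \<le> S"
      unfolding S_def by (intro sum_mono) auto
    then have "2 * (F0 + 2 * F2) * (\<Sum>i<p. (A i i)\<^sup>2) \<le> 2 * (F0 + 2 * F2) * S"
      using F0_nonneg F2_nonneg by (intro mult_left_mono) auto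
    with expectation_square_diag(2)[where p = p and a = "\<lambda>i. A i i"]
    show "expectation (\<lambda>\<omega>. (D \<omega>)\<^sup>2) \<le> 2 * (F0 + 2 * F2) * S"
      unfolding D_def m_def by linarith
    have "(B i j)\<^sup>2 \<le> (A i j)\<^sup>2 / 2 + (A j i)\<^sup>2 / 2" for i j
      using sum_squares_bound[of "A i j" "A j i"] by (auto simp: B_def power_divide power2_sum)
    then have "(\<Sum>i<p. \<Sum>j<p. (B i j)\<^sup>2) \<le> (\<Sum>i<p. \<Sum>j<p. (A i j)\<^sup>2 / 2 + (A j i)\<^sup>2 / 2)"
      by (intro sum_mono)
    also have "\<dots> = (\<Sum>i<p. \<Sum>j<p. (A i j)\<^sup>2 / 2) + (\<Sum>i<p. \<Sum>j<p. (A j i)\<^sup>2 / 2)"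
      by (simp only: sum.distrib)
    also have "(\<Sum>i<p. \<Sum>j<p. (A j i)\<^sup>2 / 2) = (\<Sum>i<p. \<Sum>j<p. (A i j)\<^sup>2 / 2)"
      by (rule sum.swap)
    also have "(\<Sum>i<p. \<Sum>j<p. (A i j)\<^sup>2 / 2) + (\<Sum>i<p. \<Sum>j<p. (A i j)\<^sup>2 / 2) = S"
      unfolding S_def by (simp add: sum_divide_distrib[symmetric])
    finally have "612 * (F0 + F1) * (\<Sum>i<p. \<Sum>j<p. (B i j)\<^sup>2) \<le> 612 * (F0 + F1) * S"
      using F0_nonneg F1_nonneg by (intro mult_left_mono) auto
    with expectation_square_offdiag[where B = B and p = p, OF B]
    show "expectation (\<lambda>\<omega>. (Q \<omega>)\<^sup>2) \<le> 612 * (F0 + F1) * S"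
      unfolding Q_def by linarith
  qed auto
  \<comment> \<open>Here \<open>1228 = 2 * 2 + 2 * 612\<close> and
    \<open>8 = 2 * 2 * 2\<close>.\<close>
  also have "\<dots> = (1228 * F0 + 1224 * F1 + 8 * F2) * S"
    by (simp add: algebra_simps)
  also have "\<dots> \<le> 1228 * (F0 + F1 + F2) * S"
    using F0_nonneg F1_nonneg F2_nonneg unfolding S_def by (intro mult_right_mono sum_nonneg) auto
  finally show ?le unfolding eq S_def .
qed

end

subsection \<open>The bound for matrices\<close>

text \<open>The three extended quantities are finite, hence equal to reals. The integrability in
  \<open>quad_form_deviation\<close> turns the nonnegative integral into an expectation.\<close>

lemma quad_form_bound_1228: "quad_form_bound TYPE('a) 1228"
  unfolding quad_form_bound_def
proof (intro allI impI ballI)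
  fix M :: "'a measure" and X \<phi> \<psi> p and A :: "real mat"
  assume M: "prob_space M \<and> moment_conditions M X \<phi> \<psi>" and A: "A \<in> carrier_mat p p"
  interpret prob_space M using M by simp
  have mc: "moment_conditions M X \<phi> \<psi>" using M by simp
  then have meas: "X k \<in> borel_measurable M" if "1 \<le> k" for k
    using that unfolding moment_conditions_def by simp
  have \<phi>: "0 \<le> \<phi> k" and \<psi>: "0 \<le> \<psi> k" if "1 \<le> k" for k
    using mc that unfolding moment_conditions_def by simp_all
  have fin: "Phi0 M X < \<infinity>" "Phi1 \<phi> < \<infinity>" "Phi2 \<psi> < \<infinity>"
    using mc unfolding moment_conditions_def by (auto simp: less_top)
  define F0 F1 F2 where "F0 = enn2real (Phi0 M X)" and "F1 = enn2real (Phi1 \<phi>)" and "F2 = enn2real (Phi2 \<psi>)"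
  have Phi: "Phi0 M X = ennreal F0" "Phi1 \<phi> = ennreal F1" "Phi2 \<psi> = ennreal F2"
    and nonneg: "0 \<le> F0" "0 \<le> F1" "0 \<le> F2"
    using fin by (simp_all add: F0_def F1_def F2_def less_top)
  have le0: "(\<integral>\<^sup>+\<omega>. ennreal (X k \<omega> ^ 4) \<partial>M) \<le> ennreal F0" if "1 \<le> k" for k
    unfolding Phi[symmetric] Phi0_def using that by (intro SUP_upper) auto
  have int4: "integrable M (\<lambda>\<omega>. X k \<omega> ^ 4)" if "1 \<le> k" for k
    using le0[OF that] meas[OF that]
    by (intro integrableI_bounded) (auto simp: less_top[symmetric] top_unique)
  \<comment> \<open>Shifting all indices by one preserves their differences, so
    \<open>\<phi>\<close> and \<open>\<psi>\<close> stay the same.\<close>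
  interpret weakly_dependent M "\<lambda>i. X (Suc i)" \<phi> \<psi> F0 F1 F2
  proof
    fix i
    show "fourth_moment M (X (Suc i))"
      using meas int4 by (simp add: fourth_moment_def)
    have "ennreal (expectation (\<lambda>\<omega>. X (Suc i) \<omega> ^ 4)) \<le> ennreal F0"
      using le0[of "Suc i"] int4[of "Suc i"] by (simp add: nn_integral_eq_integral)
    then show "expectation (\<lambda>\<omega>. X (Suc i) \<omega> ^ 4) \<le> F0"
      using nonneg by simp
  next
    fix n
    have eq: "(\<Sum>k=1..n. f k) = (\<Sum>k<n. f (Suc k))" for f :: "nat \<Rightarrow> real"
      using sum.atLeast1_atMost_eq[of f n] by simp
    have le: "ennreal (\<Sum>k<n. f k) \<le> (\<Sum>k. ennreal (f k))" if "\<And>k. 0 \<le> f k" for f :: "nat \<Rightarrow> real"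
      unfolding sum_ennreal[OF that, symmetric] by (rule sum_le_suminf) auto
    have "ennreal (\<Sum>k<n. real (Suc k) * \<phi> (Suc k)) \<le> ennreal F1"
      unfolding Phi[symmetric] Phi1_def by (rule le) (simp add: \<phi>)
    then show "(\<Sum>k=1..n. real k * \<phi> k) \<le> F1"
      unfolding eq using nonneg by simp
    have "ennreal (\<Sum>k<n. \<psi> (Suc k)) \<le> ennreal F2"
      unfolding Phi[symmetric] Phi2_def by (rule le) (simp add: \<psi>)
    then show "(\<Sum>k=1..n. \<psi> k) \<le> F2"
      unfolding eq using nonneg by simp
  next
    fix i j k l :: nat assume "i < j" "j < k" "k < l"
    then have "1 \<le> Suc i \<and> Suc i < Suc j \<and> Suc j < Suc k \<and> Suc k < Suc l" by simp
    then have "\<bar>expectation (\<lambda>\<omega>. X (Suc i) \<omega> * X (Suc j) \<omega> * X (Suc k) \<omega> * X (Suc l) \<omega>)\<bar>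
        \<le> Min {\<phi> (Suc j - Suc i), \<phi> (Suc k - Suc j), \<phi> (Suc l - Suc k)}"
      using mc unfolding moment_conditions_def by blast
    then show "\<bar>expectation (\<lambda>\<omega>. X (Suc i) \<omega> * X (Suc j) \<omega> * X (Suc k) \<omega> * X (Suc l) \<omega>)\<bar>
        \<le> Min {\<phi> (j - i), \<phi> (k - j), \<phi> (l - k)}"
      unfolding diff_Suc_Suc .
  next
    fix i j :: nat assume "i < j"
    then have "1 \<le> Suc i \<and> Suc i < Suc j" by simp
    then have "covariance M (\<lambda>\<omega>. (X (Suc i) \<omega>)\<^sup>2) (\<lambda>\<omega>. (X (Suc j) \<omega>)\<^sup>2) \<le> \<psi> (Suc j - Suc i)"
      using mc unfolding moment_conditions_def by blast
    then show "covariance M (\<lambda>\<omega>. (X (Suc i) \<omega>)\<^sup>2) (\<lambda>\<omega>. (X (Suc j) \<omega>)\<^sup>2) \<le> \<psi> (j - i)"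
      unfolding diff_Suc_Suc .
  qed (use \<phi> \<psi> in auto)
  note dev = quad_form_deviation[where p = p and A = "\<lambda>i j. A $$ (i, j)"]
  have "(\<integral>\<^sup>+\<omega>. ennreal (\<bar>scalar_prod (rv_vec X p \<omega>) (A *\<^sub>v rv_vec X p \<omega>) - mat_trace (Sigma_mat M X p * A)\<bar>\<^sup>2) \<partial>M)
      = ennreal (expectation (\<lambda>\<omega>. ((\<Sum>i<p. \<Sum>j<p. A $$ (i, j) * X (Suc i) \<omega> * X (Suc j) \<omega>)
          - (\<Sum>i<p. A $$ (i, i) * expectation (\<lambda>\<omega>. (X (Suc i) \<omega>)\<^sup>2)))\<^sup>2))"
    unfolding quad_form_eq[OF A] mat_trace_Sigma_mat[OF A] power2_abs
    by (rule nn_integral_eq_integral[OF dev(1)]) simp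
  also have "\<dots> \<le> ennreal (1228 * (F0 + F1 + F2) * (\<Sum>i<p. \<Sum>j<p. (A $$ (i, j))\<^sup>2))"
    by (rule ennreal_leI[OF dev(2)])
  also have "\<dots> = ennreal 1228 * (Phi0 M X + Phi1 \<phi> + Phi2 \<psi>) * ennreal (mat_trace (A * transpose_mat A))"
    unfolding Phi mat_trace_mult_transpose[OF A] using nonneg
    by (simp only: ennreal_mult ennreal_plus mult_nonneg_nonneg add_nonneg_nonneg sum_nonneg
        zero_le_power2 zero_le_numeral)
  finally show "(\<integral>\<^sup>+\<omega>. ennreal (\<bar>scalar_prod (rv_vec X p \<omega>) (A *\<^sub>v rv_vec X p \<omega>) - mat_trace (Sigma_mat M X p * A)\<bar>\<^sup>2) \<partial>M)
      \<le> ennreal 1228 * (Phi0 M X + Phi1 \<phi> + Phi2 \<psi>) * ennreal (mat_trace (A * transpose_mat A))" .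
qed

section \<open>Transfer to other underlying types\<close>

text \<open>Only \<open>X\<^sub>1, X\<^sub>2, \<dots>\<close> are assumed measurable, so the unused coordinate \<open>0\<close> is set to \<open>0\<close>.\<close>

lemma quad_form_bound_transfer:
  assumes "quad_form_bound TYPE(nat \<Rightarrow> real) C"
  shows "quad_form_bound TYPE('a) C"
  unfolding quad_form_bound_def
proof (intro allI impI ballI)
  fix M :: "'a measure" and X \<phi> \<psi> p and A :: "real mat"
  assume M: "prob_space M \<and> moment_conditions M X \<phi> \<psi>" and p: "1 \<le> p" and A: "A \<in> carrier_mat p p"
  interpret prob_space M using M by simp
  have mc: "moment_conditions M X \<phi> \<psi>" using M by simp
  then have meas: "X k \<in> borel_measurable M" if "1 \<le> k" for k
    using that unfolding moment_conditions_def by simp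
  define T where "T \<omega> k = (if k = 0 then 0 else X k \<omega>)" for \<omega> and k :: nat
  \<comment> \<open>\<open>N\<close> is the law of the sequence on the product space and
    \<open>Y\<close> the coordinate process. Everything that depends on the measure is built from
    integrals of measurable functions of the sequence, so it takes the same value for both.\<close>
  define N where "N = distr M (\<Pi>\<^sub>M i\<in>UNIV. borel) T"
  define Y :: "nat \<Rightarrow> (nat \<Rightarrow> real) \<Rightarrow> real" where "Y k f = f k" for k f
  have T [measurable]: "T \<in> measurable M (\<Pi>\<^sub>M i\<in>UNIV. borel)"
  proof (rule measurable_PiM_single')
    show "(\<lambda>\<omega>. T \<omega> k) \<in> borel_measurable M" for k
      using meas[of k] by (cases "k = 0") (simp_all add: T_def)
  qed (simp add: T_def)
  have Y [measurable]: "Y k \<in> borel_measurable (\<Pi>\<^sub>M i\<in>UNIV. borel)" for k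
    unfolding Y_def by (rule measurable_component_singleton) simp
  have YT: "Y k (T \<omega>) = X k \<omega>" if "1 \<le> k" for k \<omega>
    using that by (simp add: Y_def T_def)
  have int: "(\<integral>f. g f \<partial>N) = (\<integral>\<omega>. g (T \<omega>) \<partial>M)"
    if "g \<in> borel_measurable (\<Pi>\<^sub>M i\<in>UNIV. borel)" for g :: "(nat \<Rightarrow> real) \<Rightarrow> real"
    unfolding N_def by (rule integral_distr[OF T that])
  have nnint: "(\<integral>\<^sup>+f. ennreal (g f) \<partial>N) = (\<integral>\<^sup>+\<omega>. ennreal (g (T \<omega>)) \<partial>M)"
    if "g \<in> borel_measurable (\<Pi>\<^sub>M i\<in>UNIV. borel)" for g :: "(nat \<Rightarrow> real) \<Rightarrow> real"
    unfolding N_def using that by (subst nn_integral_distr[OF T]) simp_all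
  have N: "prob_space N" unfolding N_def by (rule prob_space_distr[OF T])
  have Phi0: "Phi0 N Y = Phi0 M X"
    unfolding Phi0_def by (intro SUP_cong refl) (simp add: nnint YT)
  have sq: "(\<integral>f. (Y k f)\<^sup>2 \<partial>N) = (\<integral>\<omega>. (X k \<omega>)\<^sup>2 \<partial>M)" if "1 \<le> k" for k
    using that by (simp add: int YT)
  have cov: "covariance N (\<lambda>f. (Y i f)\<^sup>2) (\<lambda>f. (Y j f)\<^sup>2) = covariance M (\<lambda>\<omega>. (X i \<omega>)\<^sup>2) (\<lambda>\<omega>. (X j \<omega>)\<^sup>2)"
    if "1 \<le> i" "1 \<le> j" for i j
    using that by (simp add: covariance_def sq int YT)
  have mom: "(\<integral>f. Y i f * Y j f * Y k f * Y l f \<partial>N) = (\<integral>\<omega>. X i \<omega> * X j \<omega> * X k \<omega> * X l \<omega> \<partial>M)"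
    if "1 \<le> i" "1 \<le> j" "1 \<le> k" "1 \<le> l" for i j k l
    using that by (simp add: int YT)
  have "moment_conditions N Y \<phi> \<psi>"
    unfolding moment_conditions_def
  proof (intro conjI allI impI)
    show "Y k \<in> borel_measurable N" for k
      unfolding N_def by simp
    show "\<bar>\<integral>f. Y i f * Y j f * Y k f * Y l f \<partial>N\<bar> \<le> Min {\<phi> (j - i), \<phi> (k - j), \<phi> (l - k)}"
      if ord: "1 \<le> i \<and> i < j \<and> j < k \<and> k < l" for i j k l
    proof -
      have "\<bar>\<integral>\<omega>. X i \<omega> * X j \<omega> * X k \<omega> * X l \<omega> \<partial>M\<bar> \<le> Min {\<phi> (j - i), \<phi> (k - j), \<phi> (l - k)}"
        using mc ord unfolding moment_conditions_def by blast
      then show ?thesis using ord by (subst mom) auto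
    qed
    show "covariance N (\<lambda>f. (Y i f)\<^sup>2) (\<lambda>f. (Y j f)\<^sup>2) \<le> \<psi> (j - i)" if ord: "1 \<le> i \<and> i < j" for i j
    proof -
      have "covariance M (\<lambda>\<omega>. (X i \<omega>)\<^sup>2) (\<lambda>\<omega>. (X j \<omega>)\<^sup>2) \<le> \<psi> (j - i)"
        using mc ord unfolding moment_conditions_def by blast
      then show ?thesis using ord by (subst cov) auto
    qed
  \<comment> \<open>The remaining conditions concern \<open>\<phi>\<close> and \<open>\<psi>\<close>
    alone or follow from the equality of the two values of \<open>Phi0\<close>.\<close>
  qed (use mc Phi0 in \<open>simp_all add: moment_conditions_def\<close>)
  with assms N p A have bound: "(\<integral>\<^sup>+f. ennreal (\<bar>scalar_prod (rv_vec Y p f) (A *\<^sub>v rv_vec Y p f)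
        - mat_trace (Sigma_mat N Y p * A)\<bar>\<^sup>2) \<partial>N)
      \<le> ennreal C * (Phi0 N Y + Phi1 \<phi> + Phi2 \<psi>) * ennreal (mat_trace (A * transpose_mat A))"
    unfolding quad_form_bound_def by blast
  have tr: "mat_trace (Sigma_mat N Y p * A) = mat_trace (Sigma_mat M X p * A)"
    unfolding mat_trace_Sigma_mat[OF A] by (simp add: sq)
  show "(\<integral>\<^sup>+\<omega>. ennreal (\<bar>scalar_prod (rv_vec X p \<omega>) (A *\<^sub>v rv_vec X p \<omega>) - mat_trace (Sigma_mat M X p * A)\<bar>\<^sup>2) \<partial>M)
      \<le> ennreal C * (Phi0 M X + Phi1 \<phi> + Phi2 \<psi>) * ennreal (mat_trace (A * transpose_mat A))"
    using bound unfolding tr Phi0 quad_form_eq[OF A]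
    by (subst (asm) nnint) (simp_all add: YT)
qed

theorem theorem4p3:
  shows "(\<exists>C>0. quad_form_bound TYPE(nat \<Rightarrow> real) C) \<and>
         (\<forall>C>0. quad_form_bound TYPE(nat \<Rightarrow> real) C \<longrightarrow> quad_form_bound TYPE('a) C)"
proof
  show "\<exists>C>0. quad_form_bound TYPE(nat \<Rightarrow> real) C"
    by (rule exI[of _ 1228]) (simp add: quad_form_bound_1228)
qed (use quad_form_bound_transfer in blast)

end
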